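(* Let $\Omega \subset T\mathbb{R}^d \cong \mathbb{R}^d \times \mathbb{R}^d$ be an open, bounded, non-empty domain. Consider a sequence of observations $\{(x^{(j)},\dot x^{(j)},\ddot x^{(j)})\}_{j\in\mathbb{N}} \subset \Omega \times \mathbb{R}^d$ of a dynamical system governed by the Euler--Lagrange equation of a non-degenerate Lagrangian $L_{\mathrm{ref}} \in \mathcal{C}^2(\overline{\Omega})$, i.e. $\mathrm{EL}(L_{\mathrm{ref}})(x^{(j)},\dot x^{(j)},\ddot x^{(j)})=0$ for all $j$. Assume that $\{(x^{(j)},\dot x^{(j)})\}_j \subset \Omega$ is topologically dense in $\Omega$. Let $K$ be a 4-times continuously differentiable kernel on $\Omega$, let $\overline{x}_b \in \Omega$, $c_b \in \mathbb{R}$, $p_b \in \mathbb{R}^d$, and assume that $L_{\mathrm{ref}}$ is contained in the reproducing kernel Hilbert space $(U,\|\cdot\|_U)$ of $K$ and fulfils the normalisation condition $$\Phi_N(L_{\mathrm{ref}}) = (p_b,c_b), \qquad \text{where } \Phi_N(L) = \left(\frac{\partial L}{\partial \dot x}(\overline{x}_b),\, L(\overline{x}_b)\right).$$ Assume that $U$ embeds continuously into $\mathcal{C}^2(\overline{\Omega})$. Let $\xi \sim \mathcal{N}(0,\mathcal{K})$ be the canonical Gaussian field on $U$. Then the sequence of conditional means $L_{(j)}$ of $\xi$ conditioned on the first $j$ observations and on the normalisation conditions, i.e. on $$\mathrm{EL}(\xi)(x^{(i)},\dot x^{(i)},\ddot x^{(i)}) = 0 \ (\forall i \le j), \qquad \Phi_N(\xi)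 = (p_b,c_b),$$ converges in $\|\cdot\|_U$ and in $\|\cdot\|_{\mathcal{C}^2(\overline{\Omega})}$ to a Lagrangian $L_{(\infty)} \in U$ such that: (1) $L_{(\infty)}$ is consistent with the normalisation, $\Phi_N(L_{(\infty)}) = (p_b,c_b)$; (2) $L_{(\infty)}$ is consistent with the dynamics, i.e. $\mathrm{EL}(L_{(\infty)})(\hat x)=0$ for all $\hat x = (x,\dot x,\ddot x)$ with $(x,\dot x)\in\Omega$ and $\mathrm{EL}(L_{\mathrm{ref}})(\hat x)=0$; (3) $L_{(\infty)}$ is the unique minimiser of $\|\cdot\|_U$ among all Lagrangians in $U$ with properties (1) and (2).
   Context: A Lagrangian is a real-valued function $L(x,\dot x)$ on (a subset of) $T\mathbb{R}^d\cong\mathbb{R}^d\times\mathbb{R}^d$. The Euler--Lagrange operator is $$\mathrm{EL}(L)(x,\dot x,\ddot x) = \frac{\partial^2 L}{\partial \dot x\partial\dot x}(x,\dot x)\,\ddot x + \frac{\partial^2 L}{\partial x\partial\dot x}(x,\dot x)\,\dot x - \frac{\partial L}{\partial x}(x,\dot x)\in\mathbb{R}^d,$$ whose $k$-th component is $\sum_i \frac{\partial^2 L}{\partial\dot x^k\partial\dot x^i}\ddot x^i + \sum_i \frac{\partial^2 L}{\partial x^i\partial\dot x^k}\dot x^i - \frac{\partial L}{\partial x^k}$. $\mathcal{C}^m(\overline{\Omega})$ is the Banach space of $m$-times continuously differentiable real functions on $\Omega$ all of whose partial derivatives of order $\le m$ extend continuously to the closure $\overline\Omega$, with norm the maximum over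 orders $\le m$ of the sup norms of the derivatives. $L_{\mathrm{ref}}\in\mathcal{C}^2(\overline\Omega)$ is non-degenerate if the matrix $\frac{\partial^2 L_{\mathrm{ref}}}{\partial\dot x\partial\dot x}(x,\dot x)$ is invertible for all $(x,\dot x)\in\overline\Omega$. A kernel $K:\Omega\times\Omega\to\mathbb{R}$ is a symmetric function such that for every finite set of distinct points the matrix $(K(\overline x^{(i)},\overline x^{(j)}))_{i,j}$ is positive definite. $U$ is its reproducing kernel Hilbert space, $U^\ast$ the topological dual, and $\mathcal{K}:U^\ast\to U$ is $\mathcal{K}(\phi)(x)=\phi(K(x,\cdot))$. The canonical Gaussian field $\xi\sim\mathcal{N}(0,\mathcal{K})$ on $U$ is a linear map $\phi\mapsto\phi(\xi)$ from $U^\ast$ to a linear space of centred Gaussian random variables (contained in $L^2$ of a probability space) such that the variance of $\phi(\xi)$ is $\phi(\mathcal{K}\phi)$; consequently $(\phi_1(\xi),\dots,\phi_m(\xi))$ is multivariate normal with covariance matrix $(\phi_i(\mathcal{K}\phi_j))_{ij}$. For $\Phi=(\phi_1,\dots,\phi_m)\in(U^\ast)^m$ and $y\in\mathbb{R}^m$ the conditional mean of $\xi$ given $\Phi(\xi)=y$ is the element $L\in U$ such that for all $\phi\in U^\ast$ the conditional distribution of $\phi(\xi)$ given $\Phi(\xi)=y$ has mean $\phi(L)$; explicitly $L=\sum_{i,j=1}^m y_i(\Theta^\dagger)_{ij}\,\mathcal{K}\phi_j$ with $\Theta_{ij}=\phi_i(\mathcal{K}\phi_j)$ and $\Theta^\dagger$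 the Moore--Penrose pseudo-inverse. Here $\Phi$ consists of all scalar components of the bounded functionals $L\mapsto\mathrm{EL}(L)(x^{(i)},\dot x^{(i)},\ddot x^{(i)})$, $i\le j$, and of $\Phi_N$, and $y=(0,\dots,0,p_b,c_b)$. *)

theory Defs
  imports "HOL-Probability.Probability"
begin

section \<open>Spaces of continuously differentiable functions\<close>

definition partial :: "'a::euclidean_space \<Rightarrow> ('a \<Rightarrow> real) \<Rightarrow> 'a \<Rightarrow> real" where
  "partial b f p = deriv (\<lambda>t::real. f (p + t *\<^sub>R b)) 0"

fun iter_partial :: "'a::euclidean_space list \<Rightarrow> ('a \<Rightarrow> real) \<Rightarrow> 'a \<Rightarrow> real" where
  "iter_partial [] f = f"
| "iter_partial (b # bs) f = partial b (iter_partial bs f)"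

definition multi_dirs :: "nat \<Rightarrow> 'a::euclidean_space list set" where
  "multi_dirs m = {bs. set bs \<subseteq> Basis \<and> length bs \<le> m}"

text \<open>Only meant for open \<open>S\<close>. A total function is used; its values off \<open>S\<close> are irrelevant.\<close>

definition Ck_on :: "nat \<Rightarrow> 'a::euclidean_space set \<Rightarrow> ('a \<Rightarrow> real) \<Rightarrow> bool" where
  "Ck_on m S f \<longleftrightarrow>
     (\<forall>bs \<in> multi_dirs m.
        continuous_on S (iter_partial bs f) \<and>
        (length bs < m \<longrightarrow> (\<forall>p\<in>S. iter_partial bs f differentiable (at p))))"

definition Ck_closure :: "nat \<Rightarrow> 'a::euclidean_space set \<Rightarrow> ('a \<Rightarrow> real) \<Rightarrow> bool" where
  "Ck_closure m S f \<longleftrightarrow>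
     Ck_on m S f \<and>
     (\<forall>bs \<in> multi_dirs m.
        \<exists>g. continuous_on (closure S) g \<and> (\<forall>p\<in>S. g p = iter_partial bs f p))"

definition Ck_norm :: "nat \<Rightarrow> 'a::euclidean_space set \<Rightarrow> ('a \<Rightarrow> real) \<Rightarrow> real" where
  "Ck_norm m S f = (MAX bs \<in> multi_dirs m. SUP p\<in>S. \<bar>iter_partial bs f p\<bar>)"


section \<open>Lagrangians and the Euler--Lagrange operator\<close>

type_synonym 'd phase = "(real^'d) \<times> (real^'d)"

definition dirx :: "'d::finite \<Rightarrow> 'd phase" where
  "dirx k = (axis k 1, 0)"

definition dirv :: "'d::finite \<Rightarrow> 'd phase" where
  "dirv k = (0, axis k 1)"

definition EL :: "('d::finite phase \<Rightarrow> real) \<Rightarrow> real^'d \<Rightarrow> real^'d \<Rightarrow> real^'d \<Rightarrow> real^'d" where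
  "EL L x v a = (\<chi> k.
       (\<Sum>i\<in>UNIV. partial (dirv k) (partial (dirv i) L) (x, v) * a $ i)
     + (\<Sum>i\<in>UNIV. partial (dirx i) (partial (dirv k) L) (x, v) * v $ i)
     - partial (dirx k) L (x, v))"

definition vel_hessian :: "('d::finite phase \<Rightarrow> real) \<Rightarrow> 'd phase \<Rightarrow> real^'d^'d" where
  "vel_hessian L p = (\<chi> k i. partial (dirv k) (partial (dirv i) L) p)"

text \<open>On the boundary of \<open>S\<close> the Hessian means the (unique) continuous extension \<open>H\<close>.\<close>

definition nondegenerate :: "'d::finite phase set \<Rightarrow> ('d phase \<Rightarrow> real) \<Rightarrow> bool" where
  "nondegenerate S L \<longleftrightarrow>
     (\<exists>H. continuous_on (closure S) H \<and> (\<forall>p\<in>S. H p = vel_hessian L p) \<and>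
          (\<forall>p\<in>closure S. invertible (H p)))"

definition PhiN :: "'d::finite phase \<Rightarrow> ('d phase \<Rightarrow> real) \<Rightarrow> (real^'d) \<times> real" where
  "PhiN pb L = ((\<chi> k. partial (dirv k) L pb), L pb)"

definition dynamics_consistent ::
  "'d::finite phase set \<Rightarrow> ('d phase \<Rightarrow> real) \<Rightarrow> ('d phase \<Rightarrow> real) \<Rightarrow> bool" where
  "dynamics_consistent S Lref L \<longleftrightarrow>
     (\<forall>x v a. (x, v) \<in> S \<and> EL Lref x v a = 0 \<longrightarrow> EL L x v a = 0)"


section \<open>Kernels and reproducing kernel Hilbert spaces\<close>

definition pd_kernel :: "'a set \<Rightarrow> ('a \<Rightarrow> 'a \<Rightarrow> real) \<Rightarrow> bool" where
  "pd_kernel S K \<longleftrightarrow>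
     (\<forall>x\<in>S. \<forall>y\<in>S. K x y = K y x) \<and>
     (\<forall>X c. finite X \<and> X \<subseteq> S \<and> (\<exists>x\<in>X. c x \<noteq> 0) \<longrightarrow>
        0 < (\<Sum>x\<in>X. \<Sum>y\<in>X. c x * c y * K x y))"

text \<open>A function on \<open>S\<close> is represented by the total function that is \<open>0\<close> off \<open>S\<close>.\<close>

definition kernel_section :: "'a set \<Rightarrow> ('a \<Rightarrow> 'a \<Rightarrow> real) \<Rightarrow> 'a \<Rightarrow> 'a \<Rightarrow> real" where
  "kernel_section S K x = (\<lambda>y. if y \<in> S then K x y else 0)"

definition ip_norm :: "(('a \<Rightarrow> real) \<Rightarrow> ('a \<Rightarrow> real) \<Rightarrow> real) \<Rightarrow> ('a \<Rightarrow> real) \<Rightarrow> real" where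
  "ip_norm ip f = sqrt (ip f f)"

definition hilbert_function_space ::
  "'a set \<Rightarrow> ('a \<Rightarrow> real) set \<Rightarrow> (('a \<Rightarrow> real) \<Rightarrow> ('a \<Rightarrow> real) \<Rightarrow> real) \<Rightarrow> bool" where
  "hilbert_function_space S U ip \<longleftrightarrow>
     (\<forall>f\<in>U. \<forall>x. x \<notin> S \<longrightarrow> f x = 0) \<and>
     (\<lambda>x. 0) \<in> U \<and>
     (\<forall>f\<in>U. \<forall>g\<in>U. \<forall>a b. (\<lambda>x. a * f x + b * g x) \<in> U) \<and>
     (\<forall>f\<in>U. \<forall>g\<in>U. ip f g = ip g f) \<and>
     (\<forall>f\<in>U. \<forall>g\<in>U. \<forall>h\<in>U. \<forall>a b. ip (\<lambda>x. a * f x + b * g x) h = a * ip f h + b * ip g h) \<and>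
     (\<forall>f\<in>U. f \<noteq> (\<lambda>x. 0) \<longrightarrow> 0 < ip f f) \<and>
     (\<forall>s :: nat \<Rightarrow> 'a \<Rightarrow> real.
        (\<forall>n. s n \<in> U) \<and>
        (\<forall>e>0. \<exists>N. \<forall>m\<ge>N. \<forall>n\<ge>N. ip_norm ip (\<lambda>x. s m x - s n x) < e) \<longrightarrow>
        (\<exists>f\<in>U. (\<lambda>n. ip_norm ip (\<lambda>x. s n x - f x)) \<longlonglongrightarrow> 0))"

text \<open>By Moore--Aronszajn, the kernel determines \<open>U\<close> and the restriction of \<open>ip\<close> to \<open>U\<close>.\<close>

definition is_rkhs ::
  "'a set \<Rightarrow> ('a \<Rightarrow> 'a \<Rightarrow> real) \<Rightarrow> ('a \<Rightarrow> real) set \<Rightarrow> (('a \<Rightarrow> real) \<Rightarrow> ('a \<Rightarrow> real) \<Rightarrow> real) \<Rightarrow> bool" where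
  "is_rkhs S K U ip \<longleftrightarrow>
     hilbert_function_space S U ip \<and>
     (\<forall>x\<in>S. kernel_section S K x \<in> U) \<and>
     (\<forall>x\<in>S. \<forall>f\<in>U. ip f (kernel_section S K x) = f x)"

text \<open>Functionals are total on functions; only their values on \<open>U\<close> matter.\<close>

definition dual_space ::
  "('a \<Rightarrow> real) set \<Rightarrow> (('a \<Rightarrow> real) \<Rightarrow> ('a \<Rightarrow> real) \<Rightarrow> real) \<Rightarrow> (('a \<Rightarrow> real) \<Rightarrow> real) set" where
  "dual_space U ip =
     {\<phi>. (\<forall>f\<in>U. \<forall>g\<in>U. \<forall>a b. \<phi> (\<lambda>x. a * f x + b * g x) = a * \<phi> f + b * \<phi> g) \<and>
         (\<exists>C. \<forall>f\<in>U. \<bar>\<phi> f\<bar> \<le> C * ip_norm ip f)}"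

definition cov_operator ::
  "'a set \<Rightarrow> ('a \<Rightarrow> 'a \<Rightarrow> real) \<Rightarrow> (('a \<Rightarrow> real) \<Rightarrow> real) \<Rightarrow> 'a \<Rightarrow> real" where
  "cov_operator S K \<phi> = (\<lambda>x. if x \<in> S then \<phi> (kernel_section S K x) else 0)"

definition continuously_embedded_Ck ::
  "nat \<Rightarrow> 'a::euclidean_space set \<Rightarrow> ('a \<Rightarrow> real) set \<Rightarrow> (('a \<Rightarrow> real) \<Rightarrow> ('a \<Rightarrow> real) \<Rightarrow> real) \<Rightarrow> bool" where
  "continuously_embedded_Ck m S U ip \<longleftrightarrow>
     (\<forall>f\<in>U. Ck_closure m S f) \<and> (\<exists>C. \<forall>f\<in>U. Ck_norm m S f \<le> C * ip_norm ip f)"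


section \<open>The canonical Gaussian field\<close>

definition centred_gaussian :: "'w measure \<Rightarrow> ('w \<Rightarrow> real) \<Rightarrow> real \<Rightarrow> bool" where
  "centred_gaussian M X var \<longleftrightarrow>
     X \<in> borel_measurable M \<and>
     (if var = 0 then AE \<omega> in M. X \<omega> = 0
      else 0 < var \<and> distributed M lborel X (\<lambda>t. ennreal (normal_density 0 (sqrt var) t)))"

text \<open>
  \<open>\<xi> \<phi>\<close> is the random variable written \<open>\<phi>(\<xi>)\<close> in the literature. Linearity is almost sure,
  and is stated so that it includes that \<open>\<xi> \<phi>\<close> depends only on \<open>\<phi>\<close> restricted to \<open>U\<close>.
\<close>

definition canonical_gaussian_field ::
  "'w measure \<Rightarrow> 'a set \<Rightarrow> ('a \<Rightarrow> 'a \<Rightarrow> real) \<Rightarrow> ('a \<Rightarrow> real) set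
   \<Rightarrow> (('a \<Rightarrow> real) \<Rightarrow> ('a \<Rightarrow> real) \<Rightarrow> real) \<Rightarrow> ((('a \<Rightarrow> real) \<Rightarrow> real) \<Rightarrow> 'w \<Rightarrow> real) \<Rightarrow> bool" where
  "canonical_gaussian_field M S K U ip \<xi> \<longleftrightarrow>
     prob_space M \<and>
     (\<forall>\<phi>\<in>dual_space U ip. centred_gaussian M (\<xi> \<phi>) (\<phi> (cov_operator S K \<phi>))) \<and>
     (\<forall>\<phi>\<in>dual_space U ip. \<forall>\<psi>\<in>dual_space U ip. \<forall>\<eta>\<in>dual_space U ip. \<forall>a b.
        (\<forall>f\<in>U. \<eta> f = a * \<phi> f + b * \<psi> f) \<longrightarrow>
        (AE \<omega> in M. \<xi> \<eta> \<omega> = a * \<xi> \<phi> \<omega> + b * \<xi> \<psi> \<omega>))"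


section \<open>Conditional distributions and conditional means\<close>

text \<open>Support of a measure on \<open>\<real>\<^sup>I\<close> for a finite index set \<open>I\<close>.\<close>

definition measure_support :: "'i set \<Rightarrow> ('i \<Rightarrow> real) measure \<Rightarrow> ('i \<Rightarrow> real) set" where
  "measure_support I \<mu> =
     {z \<in> space \<mu>. \<forall>e>0. 0 < emeasure \<mu> {w \<in> space \<mu>. \<forall>i\<in>I. \<bar>w i - z i\<bar> < e}}"

text \<open>
  \<open>\<kappa> z\<close> is the conditional distribution of \<open>X\<close> given \<open>Z = z\<close>. The event \<open>Z = z\<close> is usually null and
  the disintegration of the joint law fixes \<open>\<kappa>\<close> only up to null sets; weak continuity on the
  support of the law of \<open>Z\<close> fixes \<open>\<kappa> z\<close> for every single \<open>z\<close> in the support.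
\<close>

definition is_cond_distr ::
  "'w measure \<Rightarrow> 'i set \<Rightarrow> ('w \<Rightarrow> 'i \<Rightarrow> real) \<Rightarrow> ('w \<Rightarrow> real) \<Rightarrow> (('i \<Rightarrow> real) \<Rightarrow> real measure) \<Rightarrow> bool" where
  "is_cond_distr M I Z X \<kappa> \<longleftrightarrow>
     (let \<mu> = distr M (\<Pi>\<^sub>M i\<in>I. borel) Z in
       \<kappa> \<in> (\<Pi>\<^sub>M i\<in>I. borel) \<rightarrow>\<^sub>M prob_algebra borel \<and>
       (\<forall>A \<in> sets (\<Pi>\<^sub>M i\<in>I. borel). \<forall>B \<in> sets borel.
          emeasure M {\<omega> \<in> space M. Z \<omega> \<in> A \<and> X \<omega> \<in> B} = (\<integral>\<^sup>+ z \<in> A. emeasure (\<kappa> z) B \<partial>\<mu>)) \<and>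
       (\<forall>h :: real \<Rightarrow> real. continuous_on UNIV h \<and> bounded (range h) \<longrightarrow>
          continuous_on (measure_support I \<mu>) (\<lambda>z. \<integral>t. h t \<partial>\<kappa> z)))"

definition is_cond_mean ::
  "'w measure \<Rightarrow> ('a \<Rightarrow> real) set \<Rightarrow> (('a \<Rightarrow> real) \<Rightarrow> ('a \<Rightarrow> real) \<Rightarrow> real)
   \<Rightarrow> ((('a \<Rightarrow> real) \<Rightarrow> real) \<Rightarrow> 'w \<Rightarrow> real)
   \<Rightarrow> 'i set \<Rightarrow> ('i \<Rightarrow> ('a \<Rightarrow> real) \<Rightarrow> real) \<Rightarrow> ('i \<Rightarrow> real) \<Rightarrow> ('a \<Rightarrow> real) \<Rightarrow> bool" where
  "is_cond_mean M U ip \<xi> I \<Phi> y L \<longleftrightarrow>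
     (let Z = (\<lambda>\<omega>. \<lambda>i\<in>I. \<xi> (\<Phi> i) \<omega>) in
       L \<in> U \<and>
       restrict y I \<in> measure_support I (distr M (\<Pi>\<^sub>M i\<in>I. borel) Z) \<and>
       (\<forall>\<phi> \<in> dual_space U ip.
          \<exists>\<kappa>. is_cond_distr M I Z (\<xi> \<phi>) \<kappa> \<and>
              integrable (\<kappa> (restrict y I)) (\<lambda>t. t) \<and>
              (\<integral>t. t \<partial>\<kappa> (restrict y I)) = \<phi> L))"

definition cond_mean ::
  "'w measure \<Rightarrow> ('a \<Rightarrow> real) set \<Rightarrow> (('a \<Rightarrow> real) \<Rightarrow> ('a \<Rightarrow> real) \<Rightarrow> real)
   \<Rightarrow> ((('a \<Rightarrow> real) \<Rightarrow> real) \<Rightarrow> 'w \<Rightarrow> real)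
   \<Rightarrow> 'i set \<Rightarrow> ('i \<Rightarrow> ('a \<Rightarrow> real) \<Rightarrow> real) \<Rightarrow> ('i \<Rightarrow> real) \<Rightarrow> 'a \<Rightarrow> real" where
  "cond_mean M U ip \<xi> I \<Phi> y = (THE L. is_cond_mean M U ip \<xi> I \<Phi> y L)"


section \<open>The conditions imposed by observations and normalisation\<close>

text \<open>
  The scalar components of the condition: component \<open>k\<close> of the Euler--Lagrange equation at
  observation \<open>i\<close>, component \<open>k\<close> of the momentum, and the value at the base point.
\<close>

datatype 'd cond_index = Obs nat 'd | Momentum 'd | Val

definition cond_indices :: "nat \<Rightarrow> 'd::finite cond_index set" where
  "cond_indices j = {Obs i k | i k. i < j} \<union> range Momentum \<union> {Val}"

fun cond_functional ::
  "(nat \<Rightarrow> real^'d) \<Rightarrow> (nat \<Rightarrow> real^'d) \<Rightarrow> (nat \<Rightarrow> real^'d) \<Rightarrow> 'd::finite phase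
   \<Rightarrow> 'd cond_index \<Rightarrow> ('d phase \<Rightarrow> real) \<Rightarrow> real" where
  "cond_functional x v a pb (Obs i k) L = EL L (x i) (v i) (a i) $ k"
| "cond_functional x v a pb (Momentum k) L = fst (PhiN pb L) $ k"
| "cond_functional x v a pb Val L = snd (PhiN pb L)"

fun cond_value :: "real^'d \<Rightarrow> real \<Rightarrow> 'd::finite cond_index \<Rightarrow> real" where
  "cond_value p c (Obs i k) = 0"
| "cond_value p c (Momentum k) = p $ k"
| "cond_value p c Val = c"

end

theory Submission
  imports Defs
begin

text \<open>
  The condition functionals -- the components of \<open>EL\<close> at the observations, the momentum and the value
  at the base point -- are bounded on \<open>U\<close> because \<open>U\<close> embeds continuously into \<open>C\<^sup>2\<close>. Let \<open>r\<^sub>i\<close> be their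
  Riesz representers. The theorem has three independent ingredients.

  \<^emph>\<open>Probability.\<close> The conditional mean given finitely many conditions is the orthogonal projection
  of \<open>Lref\<close> onto the span of their representers, that is, the interpolant of least norm
  (\<open>cond_mean_eq_interpolant\<close>). Writing a representer \<open>h\<close> as an element of the span plus an element \<open>q\<close>
  orthogonal to it, the value of the field at \<open>q\<close> is independent of the conditions, which yields a
  weakly continuous conditional distribution with the right mean (\<open>W_cond_distr\<close>). That orthogonality
  implies independence rests on a uniqueness theorem for the Fourier transform of random vectors
  (\<open>distr_PiM_eqI_cos\<close>). The conditional distribution is defined pointwise through weak continuity on the
  support of the law of the conditions; so the prescribed values must lie in the support
  (\<open>W_near_pos\<close>), and there the distribution is unique (\<open>cond_distr_unique_on_support\<close>).

  \<^emph>\<open>Hilbert space geometry.\<close> The conditions cut out a decreasing sequence of closed affine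
  subspaces, all of which contain \<open>Lref\<close>. Their elements of least norm have increasing norms bounded
  by that of \<open>Lref\<close>, so by Pythagoras they form a Cauchy sequence, and the limit is the unique element
  of least norm of the intersection (\<open>nested_interpolation_converges\<close>). The embedding transfers the
  convergence to \<open>C\<^sup>2\<close>.

  \<^emph>\<open>Dynamics.\<close> The intersection consists exactly of the Lagrangians in \<open>U\<close> that satisfy the
  normalisation and are consistent with the dynamics. Invertibility of the velocity Hessian of \<open>Lref\<close>
  makes the acceleration a continuous function on \<open>\<Omega>\<close>, so the Euler--Lagrange equation for \<open>L\<close>
  extends from the dense set of observations to all of \<open>\<Omega>\<close> (\<open>dynamics_consistent_if_dense\<close>).
\<close>

section \<open>Bounded linear functionals\<close>

lemma dual_spaceI:
  assumes "\<And>f g a b. f \<in> U \<Longrightarrow> g \<in> U \<Longrightarrow> \<phi> (\<lambda>x. a * f x + b * g x) = a * \<phi> f + b * \<phi> g"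
    and "\<And>f. f \<in> U \<Longrightarrow> \<bar>\<phi> f\<bar> \<le> C * ip_norm ip f"
  shows "\<phi> \<in> dual_space U ip"
  using assms unfolding dual_space_def by blast

lemma dual_spaceE:
  assumes "\<phi> \<in> dual_space U ip"
  obtains C where "\<And>f. f \<in> U \<Longrightarrow> \<bar>\<phi> f\<bar> \<le> C * ip_norm ip f"
  using assms unfolding dual_space_def by blast

lemma dual_space_lin:
  "\<phi> \<in> dual_space U ip \<Longrightarrow> f \<in> U \<Longrightarrow> g \<in> U \<Longrightarrow> \<phi> (\<lambda>x. a * f x + b * g x) = a * \<phi> f + b * \<phi> g"
  unfolding dual_space_def by blast

lemma dual_space_scale:
  assumes "\<phi> \<in> dual_space U ip"
  shows "(\<lambda>f. c * \<phi> f) \<in> dual_space U ip"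
proof -
  obtain C where C: "\<And>f. f \<in> U \<Longrightarrow> \<bar>\<phi> f\<bar> \<le> C * ip_norm ip f" using dual_spaceE[OF assms] by blast
  have "\<bar>c * \<phi> f\<bar> \<le> (\<bar>c\<bar> * C) * ip_norm ip f" if "f \<in> U" for f
    using mult_left_mono[OF C[OF that], of "\<bar>c\<bar>"] by (simp add: abs_mult mult.assoc)
  then show ?thesis
    by (rule dual_spaceI[rotated]) (simp_all add: dual_space_lin[OF assms] algebra_simps)
qed

lemma dual_space_add:
  assumes "\<phi> \<in> dual_space U ip" "\<psi> \<in> dual_space U ip"
  shows "(\<lambda>f. \<phi> f + \<psi> f) \<in> dual_space U ip"
proof -
  obtain C where C: "\<And>f. f \<in> U \<Longrightarrow> \<bar>\<phi> f\<bar> \<le> C * ip_norm ip f" using dual_spaceE[OF assms(1)] by blast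
  obtain D where D: "\<And>f. f \<in> U \<Longrightarrow> \<bar>\<psi> f\<bar> \<le> D * ip_norm ip f" using dual_spaceE[OF assms(2)] by blast
  have "\<bar>\<phi> f + \<psi> f\<bar> \<le> (C + D) * ip_norm ip f" if "f \<in> U" for f
    using C[OF that] D[OF that] unfolding distrib_right by linarith
  then show ?thesis
    by (rule dual_spaceI[rotated]) (simp_all add: dual_space_lin[OF assms(1)] dual_space_lin[OF assms(2)] algebra_simps)
qed

lemma dual_space_sum:
  assumes "finite I" "\<And>i. i \<in> I \<Longrightarrow> \<phi> i \<in> dual_space U ip"
  shows "(\<lambda>f. \<Sum>i\<in>I. \<phi> i f) \<in> dual_space U ip"
  using assms
proof (induction I rule: finite_induct)
  case empty
  show ?case by (rule dual_spaceI[where C=0]) simp_all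
qed (simp add: dual_space_add)

section \<open>Hilbert spaces of functions\<close>

text \<open>Besides the Cauchy--Schwarz inequality, this turns almost-minimality of a quadratic functional
  into a quantitative Euler equation in the proof of the Riesz representation theorem.\<close>

lemma nonneg_quadratic_discriminant:
  fixes p q r :: real
  assumes "\<And>t. 0 \<le> r + 2 * t * q + t\<^sup>2 * p" and "0 \<le> p"
  shows "q\<^sup>2 \<le> p * r"
proof (cases "p = 0")
  case True
  have "q = 0"
  proof (rule ccontr)
    assume "q \<noteq> 0"
    with True assms(1)[of "- (r + 1) / (2 * q)"] show False by (simp add: field_simps)
  qed
  then show ?thesis using True by simp
next
  case False
  then have "p > 0" using assms(2) by simp
  then show ?thesis using assms(1)[of "- q / p"]
    by (simp add: field_simps power2_eq_square split: if_splits)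
qed

locale hilbert_functions =
  fixes S :: "'a set" and U :: "('a \<Rightarrow> real) set"
    and ip :: "('a \<Rightarrow> real) \<Rightarrow> ('a \<Rightarrow> real) \<Rightarrow> real"
  assumes hilbert: "hilbert_function_space S U ip"
begin

lemma zero_off: "f \<in> U \<Longrightarrow> x \<notin> S \<Longrightarrow> f x = 0"
  and zero_mem: "(\<lambda>x. 0) \<in> U"
  and lin_mem: "f \<in> U \<Longrightarrow> g \<in> U \<Longrightarrow> (\<lambda>x. a * f x + b * g x) \<in> U"
  and ip_sym: "f \<in> U \<Longrightarrow> g \<in> U \<Longrightarrow> ip f g = ip g f"
  and ip_lin: "f \<in> U \<Longrightarrow> g \<in> U \<Longrightarrow> h \<in> U \<Longrightarrow>
    ip (\<lambda>x. a * f x + b * g x) h = a * ip f h + b * ip g h"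
  and ip_pos: "f \<in> U \<Longrightarrow> f \<noteq> (\<lambda>x. 0) \<Longrightarrow> 0 < ip f f"
  using hilbert unfolding hilbert_function_space_def by blast+

lemma complete:
  assumes "\<And>n. s n \<in> U"
    and "\<And>e. e > 0 \<Longrightarrow> \<exists>N. \<forall>m\<ge>N. \<forall>n\<ge>N. ip_norm ip (\<lambda>x. s m x - s n x) < e"
  shows "\<exists>f\<in>U. (\<lambda>n. ip_norm ip (\<lambda>x. s n x - f x)) \<longlonglongrightarrow> 0"
  using hilbert assms unfolding hilbert_function_space_def by blast

lemma scale_mem: "f \<in> U \<Longrightarrow> (\<lambda>x. a * f x) \<in> U"
  using lin_mem[of f f a 0] by simp

lemma diff_mem: "f \<in> U \<Longrightarrow> g \<in> U \<Longrightarrow> (\<lambda>x. f x - g x) \<in> U"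
  using lin_mem[of f g 1 "-1"] by simp

lemma sum_mem: "(\<And>i. i \<in> I \<Longrightarrow> r i \<in> U) \<Longrightarrow> (\<lambda>x. \<Sum>i\<in>I. c i * r i x) \<in> U"
proof (induction I rule: infinite_finite_induct)
  case (insert k I)
  then show ?case using lin_mem[of "r k" "\<lambda>x. \<Sum>i\<in>I. c i * r i x" "c k" 1] by simp
qed (auto simp: zero_mem)

lemma ip_scale: "f \<in> U \<Longrightarrow> h \<in> U \<Longrightarrow> ip (\<lambda>x. a * f x) h = a * ip f h"
  using ip_lin[of f f h a 0] by simp

lemma ip_add: "f \<in> U \<Longrightarrow> g \<in> U \<Longrightarrow> h \<in> U \<Longrightarrow> ip (\<lambda>x. f x + g x) h = ip f h + ip g h"
  using ip_lin[of f g h 1 1] by simp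

lemma ip_diff: "f \<in> U \<Longrightarrow> g \<in> U \<Longrightarrow> h \<in> U \<Longrightarrow> ip (\<lambda>x. f x - g x) h = ip f h - ip g h"
  using ip_lin[of f g h 1 "-1"] by simp

lemma ip_zero: "h \<in> U \<Longrightarrow> ip (\<lambda>x. 0) h = 0"
  using ip_lin[of h h h 0 0] by simp

lemma ip_sum:
  "(\<And>i. i \<in> I \<Longrightarrow> r i \<in> U) \<Longrightarrow> h \<in> U \<Longrightarrow>
    ip (\<lambda>x. \<Sum>i\<in>I. c i * r i x) h = (\<Sum>i\<in>I. c i * ip (r i) h)"
proof (induction I rule: infinite_finite_induct)
  case (insert k I)
  then show ?case
    using ip_lin[of "r k" "\<lambda>x. \<Sum>i\<in>I. c i * r i x" h "c k" 1] sum_mem[of I r c] by simp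
qed (auto simp: ip_zero)

lemma ip_nonneg: "f \<in> U \<Longrightarrow> 0 \<le> ip f f"
  using ip_pos[of f] ip_zero[OF zero_mem] by (cases "f = (\<lambda>x. 0)") auto

lemma ip_eq_0: "f \<in> U \<Longrightarrow> ip f f = 0 \<Longrightarrow> f = (\<lambda>x. 0)"
  using ip_pos[of f] by auto

lemma norm_sq: "f \<in> U \<Longrightarrow> (ip_norm ip f)\<^sup>2 = ip f f"
  by (simp add: ip_norm_def ip_nonneg)

lemma norm_nonneg: "f \<in> U \<Longrightarrow> 0 \<le> ip_norm ip f"
  by (simp add: ip_norm_def ip_nonneg)

lemma ip_diff_self:
  "f \<in> U \<Longrightarrow> g \<in> U \<Longrightarrow> ip (\<lambda>x. f x - g x) (\<lambda>x. f x - g x) = ip f f - 2 * ip f g + ip g g"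
  using diff_mem[of f g]
  by (simp add: ip_diff ip_sym[of _ "\<lambda>x. f x - g x"] ip_sym[of g f])

lemma ip_lin_self:
  assumes "f \<in> U" "g \<in> U"
  shows "ip (\<lambda>x. a * f x + b * g x) (\<lambda>x. a * f x + b * g x)
    = a\<^sup>2 * ip f f + 2 * a * b * ip f g + b\<^sup>2 * ip g g"
  using assms lin_mem[of f g a b]
  by (simp add: ip_lin ip_sym[of _ "\<lambda>x. a * f x + b * g x"] ip_sym[of g f]
      power2_eq_square algebra_simps)

lemma cauchy_schwarz:
  assumes "f \<in> U" "g \<in> U"
  shows "\<bar>ip f g\<bar> \<le> ip_norm ip f * ip_norm ip g"
proof -
  have "0 \<le> ip f f + 2 * t * ip f g + t\<^sup>2 * ip g g" for t
    using ip_nonneg[OF lin_mem[OF assms, of 1 t]] ip_lin_self[OF assms, of 1 t] by simp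
  then have "(ip f g)\<^sup>2 \<le> ip g g * ip f f"
    using ip_nonneg[OF assms(2)] by (rule nonneg_quadratic_discriminant)
  also have "\<dots> = (ip_norm ip f * ip_norm ip g)\<^sup>2"
    using assms by (simp add: power_mult_distrib norm_sq)
  finally show ?thesis
    using norm_nonneg assms by (metis abs_le_square_iff abs_of_nonneg mult_nonneg_nonneg)
qed

lemma ip_in_dual_space:
  assumes h: "h \<in> U"
  shows "(\<lambda>f. ip f h) \<in> dual_space U ip"
proof (rule dual_spaceI)
  show "\<bar>ip f h\<bar> \<le> ip_norm ip h * ip_norm ip f" if "f \<in> U" for f
    using cauchy_schwarz[OF that h] by (simp add: mult.commute)
qed (simp add: ip_lin h)

lemma ip_tendsto:
  assumes "\<And>n. s n \<in> U" "f \<in> U" "g \<in> U" "(\<lambda>n. ip_norm ip (\<lambda>x. s n x - f x)) \<longlonglongrightarrow> 0"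
  shows "(\<lambda>n. ip (s n) g) \<longlonglongrightarrow> ip f g"
proof -
  have "(\<lambda>n. ip_norm ip (\<lambda>x. s n x - f x) * ip_norm ip g) \<longlonglongrightarrow> 0"
    using tendsto_mult_right[OF assms(4), of "ip_norm ip g"] by simp
  then have "(\<lambda>n. ip (s n) g - ip f g) \<longlonglongrightarrow> 0"
    by (rule Lim_null_comparison[rotated])
      (use cauchy_schwarz[OF diff_mem[OF assms(1,2)] assms(3)] in
        \<open>auto simp: ip_diff[OF assms(1,2,3)]\<close>)
  then show ?thesis by (simp add: LIM_zero_iff)
qed

text \<open>Orthogonal projection onto a finite span by Gram--Schmidt. The new vector \<open>r k\<close> splits into a
  combination of the old ones and a remainder \<open>s\<close> orthogonal to them; subtracting the component
  along \<open>s\<close> makes \<open>f\<close> orthogonal to \<open>r k\<close> without disturbing the earlier orthogonalities. The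
  vectors may be linearly dependent (\<open>s = 0\<close>), as happens with redundant observations; the
  coefficients are then not unique, but the projection is.\<close>

lemma ex_projection_coeffs:
  assumes "finite I" "\<And>i. i \<in> I \<Longrightarrow> r i \<in> U" "f \<in> U"
  shows "\<exists>c. \<forall>k\<in>I. ip (\<lambda>x. f x - (\<Sum>i\<in>I. c i * r i x)) (r k) = 0"
  using assms
proof (induction I arbitrary: f rule: finite_induct)
  case empty
  then show ?case by simp
next
  case (insert k I)
  have rI: "r i \<in> U" if "i \<in> I" for i using insert.prems(1) that by simp
  have rk: "r k \<in> U" using insert.prems(1) by simp
  obtain d where d: "\<forall>i\<in>I. ip (\<lambda>x. r k x - (\<Sum>i\<in>I. d i * r i x)) (r i) = 0"
    using insert.IH[OF rI rk] by blast
  obtain c where c: "\<forall>i\<in>I. ip (\<lambda>x. f x - (\<Sum>i\<in>I. c i * r i x)) (r i) = 0"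
    using insert.IH[OF rI insert.prems(2)] by blast
  define s where "s = (\<lambda>x. r k x - (\<Sum>i\<in>I. d i * r i x))"
  define f' where "f' = (\<lambda>x. f x - (\<Sum>i\<in>I. c i * r i x))"
  have s: "s \<in> U" unfolding s_def by (intro diff_mem sum_mem rI rk)
  have f': "f' \<in> U" unfolding f'_def by (intro diff_mem sum_mem rI insert.prems)
  define l where "l = ip f' s / ip s s"
  define f'' where "f'' = (\<lambda>x. f' x - l * s x)"
  have f'': "f'' \<in> U" unfolding f''_def by (intro diff_mem scale_mem f' s)
  have orth_I: "ip f'' (r i) = 0" if "i \<in> I" for i
    using that c d rI[OF that] f' s unfolding f''_def
    by (simp add: ip_diff ip_scale scale_mem flip: f'_def s_def)
  have orth_s: "ip f'' s = 0"
  proof (cases "ip s s = 0")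
    case True
    then have "s = (\<lambda>x. 0)" using ip_eq_0[OF s] by simp
    then show ?thesis using ip_sym[OF f'' zero_mem] ip_zero[OF f''] by simp
  next
    case False
    then have "l * ip s s = ip f' s" unfolding l_def by simp
    then show ?thesis unfolding f''_def using s f' by (simp add: ip_diff ip_scale scale_mem)
  qed
  have rk_eq: "r k = (\<lambda>x. s x + (\<Sum>i\<in>I. d i * r i x))" by (simp add: s_def)
  have sm: "(\<lambda>x. \<Sum>i\<in>I. d i * r i x) \<in> U" by (intro sum_mem rI)
  have "ip f'' (r k) = ip (r k) f''" using ip_sym f'' rk by simp
  also have "\<dots> = ip s f'' + (\<Sum>i\<in>I. d i * ip (r i) f'')"
    by (subst rk_eq) (simp add: ip_add[OF s sm f''] ip_sum[OF rI f''])
  also have "\<dots> = 0"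
    using orth_s orth_I ip_sym[OF f'' s] ip_sym[OF f'' rI] by simp
  finally have orth_k: "ip f'' (r k) = 0" .
  define e where "e = (\<lambda>i. if i = k then l else c i - l * d i)"
  have "(\<Sum>i\<in>I. e i * r i x) = (\<Sum>i\<in>I. c i * r i x) - l * (\<Sum>i\<in>I. d i * r i x)" for x
  proof -
    have "(\<Sum>i\<in>I. e i * r i x) = (\<Sum>i\<in>I. c i * r i x - l * (d i * r i x))"
      using insert.hyps by (intro sum.cong) (auto simp: e_def algebra_simps)
    then show ?thesis by (simp add: sum_subtractf sum_distrib_left)
  qed
  then have "(\<lambda>x. f x - (\<Sum>i\<in>insert k I. e i * r i x)) = f''"
    using insert.hyps by (simp add: f''_def f'_def s_def e_def algebra_simps fun_eq_iff)
  with orth_I orth_k show ?case by (intro exI[of _ e]) simp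
qed

text \<open>The representer minimises \<open>J f = \<parallel>f\<parallel>\<^sup>2 - 2 \<phi> f\<close>. If \<open>J f\<close> exceeds the infimum by at most \<open>\<epsilon>\<^sup>2\<close>, the
  discriminant of \<open>t \<mapsto> J (f + t g)\<close> shows \<open>\<bar>\<langle>f, g\<rangle> - \<phi> g\<bar> \<le> \<epsilon> \<parallel>g\<parallel>\<close> for every \<open>g\<close>. Taking for \<open>g\<close> the
  difference of two such \<open>f\<close>, a minimising sequence is Cauchy, and its limit represents \<open>\<phi>\<close>.\<close>

lemma riesz:
  assumes phi: "\<phi> \<in> dual_space U ip"
  shows "\<exists>r\<in>U. \<forall>f\<in>U. \<phi> f = ip f r"
proof -
  have lin: "\<phi> (\<lambda>x. a * f x + b * g x) = a * \<phi> f + b * \<phi> g" if "f \<in> U" "g \<in> U" for f g a b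
    using phi that unfolding dual_space_def by blast
  obtain C where C: "\<bar>\<phi> f\<bar> \<le> C * ip_norm ip f" if "f \<in> U" for f
    using phi unfolding dual_space_def by blast
  define J where "J = (\<lambda>f. ip f f - 2 * \<phi> f)"
  define m where "m = (INF f\<in>U. J f)"
  have lower: "- C\<^sup>2 \<le> J f" if "f \<in> U" for f
  proof -
    have "0 \<le> (ip_norm ip f - C)\<^sup>2" by simp
    then have "- C\<^sup>2 \<le> ip f f - 2 * (C * ip_norm ip f)"
      by (simp add: power2_diff norm_sq[OF that] algebra_simps)
    then show ?thesis using C[OF that] unfolding J_def by linarith
  qed
  have bdd: "bdd_below (J ` U)" using lower by (auto intro!: bdd_belowI[of _ "- C\<^sup>2"])
  have m_le: "m \<le> J f" if "f \<in> U" for f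
    unfolding m_def using bdd that by (rule cINF_lower)
  have near: "(ip f g - \<phi> g)\<^sup>2 \<le> ip g g * (J f - m)" if "f \<in> U" "g \<in> U" for f g
  proof (rule nonneg_quadratic_discriminant)
    fix t
    have "m \<le> J (\<lambda>x. 1 * f x + t * g x)" using m_le lin_mem[OF that] by blast
    also have "\<dots> = J f + 2 * t * (ip f g - \<phi> g) + t\<^sup>2 * ip g g"
      unfolding J_def ip_lin_self[OF that] lin[OF that] by (simp add: algebra_simps)
    finally show "0 \<le> J f - m + 2 * t * (ip f g - \<phi> g) + t\<^sup>2 * ip g g" by simp
  qed (use that ip_nonneg in auto)
  have "\<exists>f\<in>U. J f < m + (1 / real (Suc n))\<^sup>2" for n
    using cINF_less_iff[OF _ bdd, of "m + (1 / real (Suc n))\<^sup>2"] zero_mem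
    unfolding m_def by auto
  then obtain s where s: "\<And>n. s n \<in> U" "\<And>n. J (s n) < m + (1 / real (Suc n))\<^sup>2" by metis
  have near': "\<bar>ip (s n) g - \<phi> g\<bar> \<le> ip_norm ip g * (1 / real (Suc n))" if "g \<in> U" for n g
  proof -
    have "(ip (s n) g - \<phi> g)\<^sup>2 \<le> ip g g * (J (s n) - m)" using near s that by blast
    also have "\<dots> \<le> ip g g * (1 / real (Suc n))\<^sup>2"
      using s(2)[of n] ip_nonneg[OF that] by (intro mult_left_mono) auto
    also have "\<dots> = (ip_norm ip g * (1 / real (Suc n)))\<^sup>2"
      using that by (simp only: power_mult_distrib norm_sq)
    finally show ?thesis
      using norm_nonneg[OF that]
      by (metis abs_le_square_iff abs_of_nonneg mult_nonneg_nonneg of_nat_0_le_iff zero_le_divide_1_iff)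
  qed
  have dist: "ip_norm ip (\<lambda>x. s k x - s n x) \<le> 1 / real (Suc k) + 1 / real (Suc n)" for k n
  proof -
    let ?g = "\<lambda>x. s k x - s n x"
    have g: "?g \<in> U" by (intro diff_mem s)
    have "(ip_norm ip ?g)\<^sup>2 = (ip (s k) ?g - \<phi> ?g) - (ip (s n) ?g - \<phi> ?g)"
      using g s by (simp add: norm_sq ip_diff)
    also have "\<dots> \<le> ip_norm ip ?g * (1 / real (Suc k) + 1 / real (Suc n))"
      using near'[OF g, of k] near'[OF g, of n] by (simp only: distrib_left)
    finally have "ip_norm ip ?g * ip_norm ip ?g \<le> ip_norm ip ?g * (1 / real (Suc k) + 1 / real (Suc n))"
      by (simp only: power2_eq_square)
    then show ?thesis
      using norm_nonneg[OF g] by (cases "ip_norm ip ?g = 0") (simp_all only: mult_le_cancel_left, simp_all)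
  qed
  have "\<exists>f\<in>U. (\<lambda>n. ip_norm ip (\<lambda>x. s n x - f x)) \<longlonglongrightarrow> 0"
  proof (rule complete[OF s(1)])
    fix e :: real assume "e > 0"
    then obtain N where N: "inverse (real (Suc N)) < e / 2" using reals_Archimedean half_gt_zero by blast
    show "\<exists>N. \<forall>m\<ge>N. \<forall>n\<ge>N. ip_norm ip (\<lambda>x. s m x - s n x) < e"
    proof (intro exI allI impI)
      fix k n assume "N \<le> k" "N \<le> n"
      then have "1 / real (Suc k) \<le> inverse (real (Suc N))" "1 / real (Suc n) \<le> inverse (real (Suc N))"
        by (auto simp: divide_simps)
      then show "ip_norm ip (\<lambda>x. s k x - s n x) < e" using dist[of k n] N by linarith
    qed
  qed
  then obtain r where r: "r \<in> U" "(\<lambda>n. ip_norm ip (\<lambda>x. s n x - r x)) \<longlonglongrightarrow> 0" by blast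
  have "\<phi> g = ip g r" if "g \<in> U" for g
  proof -
    have "(\<lambda>n. ip_norm ip g * (1 / real (Suc n))) \<longlonglongrightarrow> ip_norm ip g * 0"
      by (rule tendsto_mult[OF tendsto_const LIMSEQ_Suc[OF lim_1_over_n]])
    then have "(\<lambda>n. ip_norm ip g * (1 / real (Suc n))) \<longlonglongrightarrow> 0"
      by (simp only: mult_zero_right)
    then have "(\<lambda>n. ip (s n) g - \<phi> g) \<longlonglongrightarrow> 0"
      by (rule Lim_null_comparison[OF eventuallyI, rotated])
        (use near'[OF that] in \<open>simp only: real_norm_def\<close>)
    then have "(\<lambda>n. ip (s n) g) \<longlonglongrightarrow> \<phi> g" by (simp add: LIM_zero_iff)
    then have "\<phi> g = ip r g" using ip_tendsto[OF s(1) r(1) that r(2)] LIMSEQ_unique by blast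
    then show ?thesis using ip_sym r that by simp
  qed
  with r show ?thesis by blast
qed

end

section \<open>Laws determined by characteristic functions\<close>

lemma integrable_bounded_finite:
  fixes f :: "'a \<Rightarrow> real"
  assumes "finite_measure M" "f \<in> borel_measurable M" "\<And>x. \<bar>f x\<bar> \<le> B"
  shows "integrable M f"
  using assms by (intro finite_measure.integrable_const_bound[of M f B]) auto

text \<open>Levy's uniqueness theorem for finite measures: after division by the common total mass, the
  cosine transforms with phases \<open>0\<close> and \<open>- \<pi> / 2\<close> are the real and imaginary parts of the
  characteristic function.\<close>

lemma real_measure_eqI_cos:
  fixes M N :: "real measure"
  assumes M: "finite_measure M" "sets M = sets borel" and N: "finite_measure N" "sets N = sets borel"
    and eq: "\<And>u \<theta>. (\<integral>x. cos (u * x + \<theta>) \<partial>M) = (\<integral>x. cos (u * x + \<theta>) \<partial>N)"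
  shows "M = N"
proof -
  have [measurable_cong, simp]: "sets M = sets borel" "sets N = sets borel" by fact+
  interpret M: finite_measure M by fact
  interpret N: finite_measure N by fact
  define m where "m = measure M (space M)"
  have mN: "m = measure N (space N)" using eq[of 0 0] by (simp add: m_def)
  show ?thesis
  proof (cases "m = 0")
    case True
    have "emeasure M A = 0" for A
      using emeasure_space[of M A] True by (simp add: m_def M.emeasure_eq_measure measure_le_0_iff)
    moreover have "emeasure N A = 0" for A
      using emeasure_space[of N A] True by (simp add: mN N.emeasure_eq_measure measure_le_0_iff)
    ultimately show ?thesis by (intro measure_eqI) simp_all
  next
    case False
    then have m: "m > 0" by (simp add: m_def less_le)
    define P where "P = (\<lambda>L :: real measure. density L (\<lambda>_. ennreal (1 / m)))"
    have real_distr: "real_distribution (P L)"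
      if "finite_measure L" "sets L = sets borel" "measure L (space L) = m" for L
    proof -
      interpret L: finite_measure L by fact
      have [measurable_cong]: "sets L = sets borel" by fact
      have "emeasure (P L) (space (P L)) = 1"
        using m that(3) by (simp add: P_def emeasure_density L.emeasure_eq_measure flip: ennreal_mult)
      then have "prob_space (P L)" by (rule prob_spaceI)
      moreover have "sets (P L) = sets borel" using that by (simp add: P_def)
      ultimately show ?thesis
        using sets_eq_imp_space_eq[of "P L" borel]
        by (simp add: real_distribution_def real_distribution_axioms_def)
    qed
    have char_P: "char (P L) t = Complex ((\<integral>x. cos (t * x + 0) \<partial>L) / m) ((\<integral>x. cos (t * x + (- pi / 2)) \<partial>L) / m)"
      if "finite_measure L" "sets L = sets borel" "measure L (space L) = m" for L t
    proof -
      interpret P: real_distribution "P L" using real_distr[OF that] .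
      have [measurable_cong]: "sets L = sets borel" by fact
      have int: "integrable (P L) (\<lambda>x. iexp (t * x))"
        using P.integrable_iexp[of "\<lambda>x. complex_of_real (t * x)"] by simp
      have "Re (char (P L) t) = (\<integral>x. cos (t * x) \<partial>P L)"
        unfolding char_def by (subst integral_Re[OF int, symmetric]) (simp add: Re_exp)
      moreover have "Im (char (P L) t) = (\<integral>x. sin (t * x) \<partial>P L)"
        unfolding char_def by (subst integral_Im[OF int, symmetric]) (simp add: Im_exp)
      moreover have "(\<integral>x. cos (t * x) \<partial>P L) = (\<integral>x. cos (t * x + 0) \<partial>L) / m"
        unfolding P_def using m by (subst integral_density) auto
      moreover have "(\<integral>x. sin (t * x) \<partial>P L) = (\<integral>x. cos (t * x + (- pi / 2)) \<partial>L) / m"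
        unfolding P_def using m by (subst integral_density) (auto simp: cos_diff)
      ultimately show ?thesis by (simp add: complex_eq_iff)
    qed
    have "P M = P N"
    proof (intro Levy_uniqueness real_distr ext)
      show "char (P M) t = char (P N) t" for t
        by (simp only: char_P[OF M m_def[symmetric]] char_P[OF N mN[symmetric]] eq)
    qed (use M N m_def mN in simp_all)
    have "emeasure M A = emeasure N A" if "A \<in> sets borel" for A
    proof -
      have "ennreal (1 / m) * emeasure M A = ennreal (1 / m) * emeasure N A"
        using arg_cong[OF \<open>P M = P N\<close>, of "\<lambda>L. emeasure L A"] that
        by (simp add: P_def emeasure_density nn_integral_cmult_indicator)
      then show ?thesis using m by (simp add: ennreal_mult_cancel_left)
    qed
    then show ?thesis by (intro measure_eqI) simp_all
  qed
qed

text \<open>One-dimensional uniqueness for the laws of \<open>X\<close> and \<open>Y\<close> under the densities \<open>w\<close> and \<open>v\<close>. The weights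
  will carry all other coordinates of a random vector, so that one coordinate at a time can be
  localised to a Borel set.\<close>

lemma weighted_indicator_integral_eq:
  fixes X w :: "'a \<Rightarrow> real" and Y v :: "'b \<Rightarrow> real"
  assumes M: "finite_measure M" "X \<in> borel_measurable M" "w \<in> borel_measurable M"
      "\<And>x. 0 \<le> w x" "\<And>x. w x \<le> C"
    and N: "finite_measure N" "Y \<in> borel_measurable N" "v \<in> borel_measurable N"
      "\<And>x. 0 \<le> v x" "\<And>x. v x \<le> C"
    and eq: "\<And>u \<theta>. (\<integral>x. w x * cos (u * X x + \<theta>) \<partial>M) = (\<integral>x. v x * cos (u * Y x + \<theta>) \<partial>N)"
    and B: "B \<in> sets borel"
  shows "(\<integral>x. w x * indicator B (X x) \<partial>M) = (\<integral>x. v x * indicator B (Y x) \<partial>N)"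
proof -
  have fin: "finite_measure (distr (density L w) borel X)"
    if "finite_measure L" "X \<in> borel_measurable L" "w \<in> borel_measurable L"
      "\<And>x. 0 \<le> w x" "\<And>x. w x \<le> C" for L :: "'c measure" and X w :: "'c \<Rightarrow> real"
  proof (rule finite_measureI)
    interpret L: finite_measure L by fact
    have [measurable]: "X \<in> borel_measurable L" "w \<in> borel_measurable L" by fact+
    have "emeasure (distr (density L w) borel X) (space (distr (density L w) borel X)) = (\<integral>\<^sup>+x. w x \<partial>L)"
      by (simp add: emeasure_distr emeasure_density cong: nn_integral_cong)
    also have "\<dots> \<le> (\<integral>\<^sup>+x. ennreal C \<partial>L)" using that by (intro nn_integral_mono ennreal_leI) auto
    also have "\<dots> < \<infinity>" by (simp add: L.emeasure_eq_measure ennreal_mult_less_top)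
    finally show "emeasure (distr (density L w) borel X) (space (distr (density L w) borel X)) \<noteq> \<infinity>"
      by simp
  qed
  have int: "(\<integral>x. h x \<partial>distr (density L w) borel X) = (\<integral>x. w x * h (X x) \<partial>L)"
    if "X \<in> borel_measurable L" "w \<in> borel_measurable L"
      "\<And>x. 0 \<le> w x" "h \<in> borel_measurable borel" for L :: "'c measure" and X w and h :: "real \<Rightarrow> real"
  proof -
    have [measurable]: "X \<in> borel_measurable L" "w \<in> borel_measurable L" "h \<in> borel_measurable borel"
      by fact+
    show ?thesis using that(3) by (simp add: integral_distr integral_density)
  qed
  have "distr (density M w) borel X = distr (density N v) borel Y"
    by (intro real_measure_eqI_cos fin[OF M] fin[OF N])
      (auto simp: int[OF M(2-4)] int[OF N(2-4)] eq)
  then have "(\<integral>x. indicator B x \<partial>distr (density M w) borel X)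
    = (\<integral>x. (indicator B x :: real) \<partial>distr (density N v) borel Y)" by simp
  then show ?thesis using B by (simp only: int[OF M(2-4)] int[OF N(2-4)] borel_measurable_indicator)
qed

text \<open>Mixed transform: restricted to a box in the coordinates \<open>J\<close>, Fourier transformed in the others.\<close>

definition box_cos_integral ::
  "'a measure \<Rightarrow> 'i set \<Rightarrow> ('i \<Rightarrow> 'a \<Rightarrow> real) \<Rightarrow> 'i set \<Rightarrow> ('i \<Rightarrow> real set) \<Rightarrow> ('i \<Rightarrow> real) \<Rightarrow> real \<Rightarrow> real" where
  "box_cos_integral M I X J B t \<theta> =
    (\<integral>x. (\<Prod>i\<in>J. indicator (B i) (X i x)) * cos ((\<Sum>i\<in>I - J. t i * X i x) + \<theta>) \<partial>M)"

lemma prod_indicator_bounds: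
  "0 \<le> (\<Prod>i\<in>J. indicator (B i) (X i) :: real)" "(\<Prod>i\<in>J. indicator (B i) (X i) :: real) \<le> 1"
  by (auto intro!: prod_nonneg prod_le_1 split: split_indicator)

text \<open>By the product-to-sum formula, the cosine transform of \<open>X k\<close> under the weight \<open>P (1 + a cos S)\<close>,
  with \<open>P\<close> the indicator of the box and \<open>S\<close> a combination of the coordinates outside
  \<open>insert k J\<close>, only involves mixed transforms over the smaller set \<open>J\<close>. The weight is non-negative
  for \<open>a = 0\<close> and \<open>a = 1\<close>, which is the reason for the summand \<open>1\<close>.\<close>

lemma box_cos_integral_product:
  fixes X :: "'i \<Rightarrow> 'a \<Rightarrow> real"
  assumes M: "finite_measure M" "\<And>i. i \<in> I \<Longrightarrow> X i \<in> borel_measurable M"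
    and I: "finite I" "J \<subseteq> I" "k \<in> I - J" and B: "\<And>i. B i \<in> sets borel"
  shows "(\<integral>x. ((\<Prod>i\<in>J. indicator (B i) (X i x)) * (1 + a * cos ((\<Sum>i\<in>I - insert k J. t i * X i x) + \<theta>)))
      * cos (u * X k x + \<theta>') \<partial>M)
    = box_cos_integral M I X J B ((\<lambda>_. 0)(k := u)) \<theta>'
      + a / 2 * box_cos_integral M I X J B (t(k := - u)) (\<theta> - \<theta>')
      + a / 2 * box_cos_integral M I X J B (t(k := u)) (\<theta> + \<theta>')"
proof -
  have R: "I - J = insert k (I - insert k J)" "k \<notin> I - insert k J" "finite (I - insert k J)"
    using I by auto
  have sum: "(\<Sum>i\<in>I - J. (s(k := c)) i * X i x) = c * X k x + (\<Sum>i\<in>I - insert k J. s i * X i x)"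
    for s c x
  proof -
    have "(\<Sum>i\<in>I - insert k J. (s(k := c)) i * X i x) = (\<Sum>i\<in>I - insert k J. s i * X i x)"
      by (intro sum.cong) auto
    then show ?thesis by (subst R(1)) (simp add: sum.insert[OF R(3,2)])
  qed
  let ?P = "\<lambda>x. \<Prod>i\<in>J. indicator (B i) (X i x) :: real"
  let ?S = "\<lambda>x. \<Sum>i\<in>I - insert k J. t i * X i x"
  have meas [measurable]: "\<And>i. i \<in> I \<Longrightarrow> X i \<in> borel_measurable M" "\<And>i. B i \<in> sets borel"
    by fact+
  have PJ [measurable]: "?P \<in> borel_measurable M"
    using I(2) by (intro borel_measurable_prod) (auto intro!: borel_measurable_indicator' meas)
  have S [measurable]: "?S \<in> borel_measurable M" by (intro borel_measurable_sum) auto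
  have k [measurable]: "X k \<in> borel_measurable M" using I by auto
  have int: "integrable M (\<lambda>x. ?P x * cos (h x))" if [measurable]: "h \<in> borel_measurable M" for h
  proof (rule integrable_bounded_finite[OF M(1), where B=1])
    fix x show "\<bar>?P x * cos (h x)\<bar> \<le> 1"
      using prod_indicator_bounds[where J=J and B=B and X="\<lambda>i. X i x"] 
      by (simp add: abs_mult) (metis abs_cos_le_one abs_ge_zero mult_le_one)
  qed measurable
  have eq: "?P x * (1 + a * cos (?S x + \<theta>)) * cos (u * X k x + \<theta>')
    = ?P x * cos (u * X k x + \<theta>') + a / 2 * (?P x * cos (- u * X k x + ?S x + (\<theta> - \<theta>')))
      + a / 2 * (?P x * cos (u * X k x + ?S x + (\<theta> + \<theta>')))" for x
  proof -
    have "cos (?S x + \<theta>) * cos (u * X k x + \<theta>')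
      = cos (- u * X k x + ?S x + (\<theta> - \<theta>')) / 2 + cos (u * X k x + ?S x + (\<theta> + \<theta>')) / 2"
      using cos_times_cos[of "?S x + \<theta>" "u * X k x + \<theta>'"]
      by (simp add: add_divide_distrib algebra_simps)
    then show ?thesis by (simp add: distrib_left distrib_right mult.assoc) 
        (simp add: distrib_left mult.left_commute flip: mult.assoc)
  qed
  have lin3: "(\<integral>x. f x + c * g x + d * h x \<partial>M) = (\<integral>x. f x \<partial>M) + c * (\<integral>x. g x \<partial>M) + d * (\<integral>x. h x \<partial>M)"
    if "integrable M f" "integrable M g" "integrable M h" for f g h :: "'a \<Rightarrow> real" and c d
    using that by simp
  show ?thesis
    unfolding eq box_cos_integral_def sum
    using int by (subst lin3) simp_all
qed

text \<open>The uniqueness theorem for random vectors, reduced to dimension one. The coordinates are moved one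
  by one from the Fourier side to the box side: under a non-negative weight that depends on the other
  coordinates, the law of \<open>X k\<close> is determined by its cosine transform. As \<open>cos S\<close> is not a
  non-negative weight, it is written as the difference of \<open>1 + cos S\<close> and \<open>1\<close>. Once all coordinates
  are on the box side, the two laws agree on boxes, which generate the product \<open>\<sigma>\<close>-algebra.\<close>

proposition distr_PiM_eqI_cos:
  fixes X :: "'i \<Rightarrow> 'a \<Rightarrow> real" and Y :: "'i \<Rightarrow> 'b \<Rightarrow> real"
  assumes M: "finite_measure M" "\<And>i. i \<in> I \<Longrightarrow> X i \<in> borel_measurable M"
    and N: "finite_measure N" "\<And>i. i \<in> I \<Longrightarrow> Y i \<in> borel_measurable N"
    and I: "finite I"
    and eq: "\<And>t \<theta>. (\<integral>x. cos ((\<Sum>i\<in>I. t i * X i x) + \<theta>) \<partial>M) = (\<integral>x. cos ((\<Sum>i\<in>I. t i * Y i x) + \<theta>) \<partial>N)"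
  shows "distr M (\<Pi>\<^sub>M i\<in>I. borel) (\<lambda>x. \<lambda>i\<in>I. X i x) = distr N (\<Pi>\<^sub>M i\<in>I. borel) (\<lambda>x. \<lambda>i\<in>I. Y i x)"
proof -
  interpret M: finite_measure M by fact
  interpret N: finite_measure N by fact
  have box: "box_cos_integral M I X J B t \<theta> = box_cos_integral N I Y J B t \<theta>"
    if "J \<subseteq> I" "\<And>i. B i \<in> sets borel" for J B t \<theta>
    using finite_subset[OF that(1) I] that(1)
  proof (induction J arbitrary: t \<theta> rule: finite_induct)
    case empty
    then show ?case by (simp add: box_cos_integral_def eq)
  next
    case (insert k J)
    then have J: "J \<subseteq> I" "k \<in> I - J" by auto
    have IH: "box_cos_integral M I X J B t \<theta> = box_cos_integral N I Y J B t \<theta>" for t \<theta>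
      using insert.IH J by blast
    have sets [measurable]: "\<And>i. B i \<in> sets borel" by fact
    let ?w = "\<lambda>(Z :: 'i \<Rightarrow> real) a. (\<Prod>i\<in>J. indicator (B i) (Z i)) * (1 + a * cos ((\<Sum>i\<in>I - insert k J. t i * Z i) + \<theta>))"
    have bounds: "0 \<le> ?w Z a" "?w Z a \<le> 2" if "a \<in> {0,1}" for Z a
    proof -
      define c where "c = cos ((\<Sum>i\<in>I - insert k J. t i * Z i) + \<theta>)"
      have c: "- 1 \<le> c" "c \<le> 1" by (simp_all add: c_def)
      have "0 \<le> 1 + a * c" "1 + a * c \<le> 2"
        using that c by auto
      then show "0 \<le> ?w Z a" "?w Z a \<le> 2"
        using prod_indicator_bounds[where J=J and B=B and X=Z] mult_mono[of "\<Prod>i\<in>J. indicator (B i) (Z i)" 1 "1 + a * c" 2]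
        unfolding c_def by auto
    qed
    have meas: "(\<lambda>x. ?w (\<lambda>i. Z i x) a) \<in> borel_measurable L"
      if "\<And>i. i \<in> I \<Longrightarrow> Z i \<in> borel_measurable L" for L :: "'c measure" and Z a
    proof -
      have [measurable]: "\<And>i. i \<in> I \<Longrightarrow> Z i \<in> borel_measurable L" by fact
      have "(\<lambda>x. \<Prod>i\<in>J. indicator (B i) (Z i x) :: real) \<in> borel_measurable L"
        using J by (intro borel_measurable_prod) (auto intro!: borel_measurable_indicator' that sets)
      moreover have "(\<lambda>x. \<Sum>i\<in>I - insert k J. t i * Z i x) \<in> borel_measurable L"
        using that by (intro borel_measurable_sum) auto
      ultimately show ?thesis by measurable
    qed
    have weighted: "(\<integral>x. ?w (\<lambda>i. X i x) a * indicator (B k) (X k x) \<partial>M)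
      = (\<integral>x. ?w (\<lambda>i. Y i x) a * indicator (B k) (Y k x) \<partial>N)" if a: "a \<in> {0,1}" for a
    proof (rule weighted_indicator_integral_eq[where C=2])
      fix u \<theta>'
      show "(\<integral>x. ?w (\<lambda>i. X i x) a * cos (u * X k x + \<theta>') \<partial>M) = (\<integral>x. ?w (\<lambda>i. Y i x) a * cos (u * Y k x + \<theta>') \<partial>N)"
        using box_cos_integral_product[where X=X and B=B and t=t and a=a and \<theta>=\<theta> and u=u and \<theta>'=\<theta>', OF M I J sets]
          box_cos_integral_product[where X=Y and B=B and t=t and a=a and \<theta>=\<theta> and u=u and \<theta>'=\<theta>', OF N I J sets]
        by (simp only: IH)
    qed (use J(2) in \<open>auto intro!: M N meas bounds a sets\<close>)
    have diff: "box_cos_integral L I Z (insert k J) B t \<theta>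
      = (\<integral>x. ?w (\<lambda>i. Z i x) 1 * indicator (B k) (Z k x) \<partial>L) - (\<integral>x. ?w (\<lambda>i. Z i x) 0 * indicator (B k) (Z k x) \<partial>L)"
      if L: "finite_measure L" "\<And>i. i \<in> I \<Longrightarrow> Z i \<in> borel_measurable L" for L :: "'c measure" and Z
    proof -
      have int: "integrable L (\<lambda>x. ?w (\<lambda>i. Z i x) a * indicator (B k) (Z k x))" if "a \<in> {0,1}" for a
      proof (rule integrable_bounded_finite[OF L(1), where B=2])
        show "(\<lambda>x. ?w (\<lambda>i. Z i x) a * indicator (B k) (Z k x)) \<in> borel_measurable L"
        proof (intro borel_measurable_times[of "\<lambda>x. ?w (\<lambda>i. Z i x) a"])
          show "(\<lambda>x. ?w (\<lambda>i. Z i x) a) \<in> borel_measurable L" using L(2) by (rule meas)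
          have [measurable]: "Z k \<in> borel_measurable L" using J L(2) by simp
          show "(\<lambda>x. indicator (B k) (Z k x) :: real) \<in> borel_measurable L" by measurable
        qed
        show "\<bar>?w (\<lambda>i. Z i x) a * indicator (B k) (Z k x)\<bar> \<le> 2" for x
          using bounds[OF that, of "\<lambda>i. Z i x"] by (auto simp: abs_mult split: split_indicator)
      qed
      show ?thesis
        unfolding box_cos_integral_def
        using insert.hyps
        by (subst Bochner_Integration.integral_diff[OF int int, symmetric])
          (auto simp: algebra_simps intro!: Bochner_Integration.integral_cong)
    qed
    show ?case using weighted[of 0] weighted[of 1] diff[of M X, OF M] diff[of N Y, OF N] by simp
  qed
  \<comment> \<open>The mixed transform wants a Borel set for every index; off \<open>I\<close> the value \<open>{}\<close> is arbitrary.\<close>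
  have rect: "emeasure (distr L (\<Pi>\<^sub>M i\<in>I. borel) (\<lambda>x. \<lambda>i\<in>I. Z i x)) (\<Pi>\<^sub>E i\<in>I. A i)
      = ennreal (box_cos_integral L I Z I (\<lambda>i. if i \<in> I then A i else {}) (\<lambda>_. 0) 0)"
    if L: "finite_measure L" "\<And>i. i \<in> I \<Longrightarrow> Z i \<in> borel_measurable L" and A: "\<And>i. i \<in> I \<Longrightarrow> A i \<in> sets borel"
    for L :: "'c measure" and Z A
  proof -
    interpret L: finite_measure L by fact
    have m [measurable]: "(\<lambda>x. \<lambda>i\<in>I. Z i x) \<in> L \<rightarrow>\<^sub>M (\<Pi>\<^sub>M i\<in>I. borel)"
      using L(2) by (rule measurable_restrict)
    have s [measurable]: "(\<Pi>\<^sub>E i\<in>I. A i) \<in> sets (\<Pi>\<^sub>M i\<in>I. borel)"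
      using A I by (intro sets_PiM_I_finite) auto
    let ?E = "(\<lambda>x. \<lambda>i\<in>I. Z i x) -` (\<Pi>\<^sub>E i\<in>I. A i) \<inter> space L"
    have "(\<Prod>i\<in>I. indicator (if i \<in> I then A i else {}) (Z i x)) = (indicator ?E x :: real)"
      if x: "x \<in> space L" for x
    proof (cases "x \<in> ?E")
      case True
      then have "\<And>i. i \<in> I \<Longrightarrow> Z i x \<in> A i" by (auto simp: PiE_iff)
      with True show ?thesis by simp
    next
      case False
      then obtain i where "i \<in> I" "Z i x \<notin> A i" using x by (auto simp: PiE_iff)
      with False show ?thesis using I by (auto intro!: prod_zero bexI[of _ i])
    qed
    then have "box_cos_integral L I Z I (\<lambda>i. if i \<in> I then A i else {}) (\<lambda>_. 0) 0 = (\<integral>x. indicator ?E x \<partial>L)"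
      unfolding box_cos_integral_def by (intro Bochner_Integration.integral_cong) auto
    also have "\<dots> = measure L ?E" using measurable_sets[OF m s] by simp
    finally show ?thesis by (simp add: emeasure_distr L.emeasure_eq_measure)
  qed
  show ?thesis
  proof (rule measure_eqI_PiM_finite[OF I, where A = "\<lambda>_. \<Pi>\<^sub>E i\<in>I. UNIV"])
    fix A :: "'i \<Rightarrow> real set" assume A: "\<And>i. i \<in> I \<Longrightarrow> A i \<in> sets borel"
    show "emeasure (distr M (\<Pi>\<^sub>M i\<in>I. borel) (\<lambda>x. \<lambda>i\<in>I. X i x)) (\<Pi>\<^sub>E i\<in>I. A i)
      = emeasure (distr N (\<Pi>\<^sub>M i\<in>I. borel) (\<lambda>x. \<lambda>i\<in>I. Y i x)) (\<Pi>\<^sub>E i\<in>I. A i)"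
      using A using rect[of M X A, OF M A] rect[of N Y A, OF N A] by (simp add: box)
  next
    show "emeasure (distr M (\<Pi>\<^sub>M i\<in>I. borel) (\<lambda>x. \<lambda>i\<in>I. X i x)) (\<Pi>\<^sub>E i\<in>I. UNIV) \<noteq> \<infinity>"
      using rect[of M X "\<lambda>_. UNIV", OF M] by simp
  qed (auto simp: space_PiM intro!: prod_algebraI_finite I)
qed

text \<open>The hypothesis is the addition theorem for the cosine with the expectation taken factor by factor;
  it says that \<open>(X, Z)\<close> on \<open>M\<close> and \<open>(X \<circ> fst, Z \<circ> snd)\<close> on \<open>M \<Otimes>\<^sub>M M\<close> have the same cosine
  transforms. Both are regarded as vectors indexed by an option type, with \<open>None\<close> for \<open>X\<close>.\<close>

proposition (in prob_space) distr_Pair_eq_pair_measureI_cos: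
  fixes X :: "'a \<Rightarrow> real" and Z :: "'i \<Rightarrow> 'a \<Rightarrow> real"
  assumes X [measurable]: "X \<in> borel_measurable M"
    and Z [measurable]: "\<And>i. i \<in> I \<Longrightarrow> Z i \<in> borel_measurable M" and I: "finite I"
    and eq: "\<And>s t \<theta>. expectation (\<lambda>x. cos (s * X x + (\<Sum>i\<in>I. t i * Z i x) + \<theta>))
      = expectation (\<lambda>x. cos (s * X x)) * expectation (\<lambda>x. cos ((\<Sum>i\<in>I. t i * Z i x) + \<theta>))
      - expectation (\<lambda>x. sin (s * X x)) * expectation (\<lambda>x. sin ((\<Sum>i\<in>I. t i * Z i x) + \<theta>))"
  shows "distr M (borel \<Otimes>\<^sub>M (\<Pi>\<^sub>M i\<in>I. borel)) (\<lambda>x. (X x, \<lambda>i\<in>I. Z i x))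
    = distr M borel X \<Otimes>\<^sub>M distr M (\<Pi>\<^sub>M i\<in>I. borel) (\<lambda>x. \<lambda>i\<in>I. Z i x)"
proof -
  interpret P: pair_prob_space M M ..
  define J where "J = insert None (Some ` I)"
  define F where "F = (\<lambda>j x. case j of None \<Rightarrow> X x | Some i \<Rightarrow> Z i x)"
  define G where "G = (\<lambda>j (x, y). case j of None \<Rightarrow> X x | Some i \<Rightarrow> Z i y)"
  have J: "finite J" unfolding J_def using I by simp
  have sums: "(\<Sum>j\<in>J. t j * F j x) = t None * X x + (\<Sum>i\<in>I. t (Some i) * Z i x)"
    "(\<Sum>j\<in>J. t j * G j (x, y)) = t None * X x + (\<Sum>i\<in>I. t (Some i) * Z i y)" for t x y
    using I by (simp_all add: J_def F_def G_def sum.reindex)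
  have F: "F j \<in> borel_measurable M" if "j \<in> J" for j
    using that by (auto simp: J_def F_def)
  have G: "G j \<in> borel_measurable (M \<Otimes>\<^sub>M M)" if "j \<in> J" for j
    using that by (auto simp: J_def G_def split_beta')
  have laws: "distr M (\<Pi>\<^sub>M j\<in>J. borel) (\<lambda>x. \<lambda>j\<in>J. F j x) = distr (M \<Otimes>\<^sub>M M) (\<Pi>\<^sub>M j\<in>J. borel) (\<lambda>x. \<lambda>j\<in>J. G j x)"
  proof (rule distr_PiM_eqI_cos[OF finite_measure_axioms F P.finite_measure_axioms G J])
    fix t \<theta>
    let ?T = "\<lambda>y. (\<Sum>i\<in>I. t (Some i) * Z i y) + \<theta>"
    have T [measurable]: "?T \<in> borel_measurable M" by measurable
    have int1: "integrable M (\<lambda>x. cos (h x))" "integrable M (\<lambda>x. sin (h x))"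
      if [measurable]: "h \<in> borel_measurable M" for h :: "'a \<Rightarrow> real"
      by (auto intro!: integrable_bounded_finite[OF finite_measure_axioms, where B=1])
    have int2: "integrable (M \<Otimes>\<^sub>M M) (\<lambda>z. cos ((\<Sum>j\<in>J. t j * G j z) + \<theta>))"
      using G by (intro integrable_bounded_finite[OF P.finite_measure_axioms, where B=1]) auto
    have "(\<integral>z. cos ((\<Sum>j\<in>J. t j * G j z) + \<theta>) \<partial>(M \<Otimes>\<^sub>M M))
      = (\<integral>x. \<integral>y. cos ((\<Sum>j\<in>J. t j * G j (x, y)) + \<theta>) \<partial>M \<partial>M)"
      using P.integral_fst'[OF int2] by simp
    also have "\<dots> = (\<integral>x. \<integral>y. cos (t None * X x) * cos (?T y) - sin (t None * X x) * sin (?T y) \<partial>M \<partial>M)"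
      unfolding sums by (simp only: cos_add add.assoc)
    also have "\<dots> = (\<integral>x. cos (t None * X x) * expectation (\<lambda>y. cos (?T y))
        - sin (t None * X x) * expectation (\<lambda>y. sin (?T y)) \<partial>M)"
      by (simp add: Bochner_Integration.integral_diff int1 integrable_mult_right)
    also have "\<dots> = expectation (\<lambda>x. cos (t None * X x)) * expectation (\<lambda>y. cos (?T y))
        - expectation (\<lambda>x. sin (t None * X x)) * expectation (\<lambda>y. sin (?T y))"
      by (subst Bochner_Integration.integral_diff) (auto intro!: int1 integrable_mult_left)
    also have "\<dots> = (\<integral>x. cos ((\<Sum>j\<in>J. t j * F j x) + \<theta>) \<partial>M)"
      unfolding sums eq ..
    finally show "(\<integral>x. cos ((\<Sum>j\<in>J. t j * F j x) + \<theta>) \<partial>M)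
      = (\<integral>z. cos ((\<Sum>j\<in>J. t j * G j z) + \<theta>) \<partial>(M \<Otimes>\<^sub>M M))" ..
  qed
  define R where "R = (\<lambda>f :: 'i option \<Rightarrow> real. (f None, \<lambda>i\<in>I. f (Some i)))"
  have R [measurable]: "R \<in> (\<Pi>\<^sub>M j\<in>J. borel) \<rightarrow>\<^sub>M borel \<Otimes>\<^sub>M (\<Pi>\<^sub>M i\<in>I. borel)"
    unfolding R_def by (intro measurable_Pair measurable_restrict measurable_component_singleton) (auto simp: J_def)
  have RF: "R (\<lambda>j\<in>J. F j x) = (X x, \<lambda>i\<in>I. Z i x)" for x
    by (auto simp: R_def J_def F_def)
  have RG: "R (\<lambda>j\<in>J. G j (x, y)) = (X x, \<lambda>i\<in>I. Z i y)" for x y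
    by (auto simp: R_def J_def G_def)
  have mZ [measurable]: "(\<lambda>x. \<lambda>i\<in>I. Z i x) \<in> M \<rightarrow>\<^sub>M (\<Pi>\<^sub>M i\<in>I. borel)"
    by (intro measurable_restrict Z)
  interpret D: prob_space "distr M (\<Pi>\<^sub>M i\<in>I. borel) (\<lambda>x. \<lambda>i\<in>I. Z i x)"
    by (rule prob_space_distr) measurable
  have "distr M (borel \<Otimes>\<^sub>M (\<Pi>\<^sub>M i\<in>I. borel)) (\<lambda>x. (X x, \<lambda>i\<in>I. Z i x))
    = distr (distr M (\<Pi>\<^sub>M j\<in>J. borel) (\<lambda>x. \<lambda>j\<in>J. F j x)) (borel \<Otimes>\<^sub>M (\<Pi>\<^sub>M i\<in>I. borel)) R"
    by (subst distr_distr) (auto simp: comp_def RF intro!: measurable_restrict F)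
  also have "\<dots> = distr (M \<Otimes>\<^sub>M M) (borel \<Otimes>\<^sub>M (\<Pi>\<^sub>M i\<in>I. borel)) (\<lambda>(x, y). (X x, \<lambda>i\<in>I. Z i y))"
    unfolding laws by (subst distr_distr) (auto simp: comp_def RG split_beta' intro!: measurable_restrict G distr_cong)
  also have "\<dots> = distr M borel X \<Otimes>\<^sub>M distr M (\<Pi>\<^sub>M i\<in>I. borel) (\<lambda>x. \<lambda>i\<in>I. Z i x)"
    by (rule pair_measure_distr[symmetric]) (auto intro: D.sigma_finite_measure_axioms)
  finally show ?thesis .
qed

section \<open>Conditional distributions at a single point\<close>

text \<open>Every point outside the support lies in a null box with rational centre and radius, and there are
  only countably many of those.\<close>

lemma AE_in_measure_support:
  fixes \<mu> :: "('i \<Rightarrow> real) measure"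
  assumes I: "finite I" and sets_mu: "sets \<mu> = sets (\<Pi>\<^sub>M i\<in>I. borel)"
  shows "AE z in \<mu>. z \<in> measure_support I \<mu>"
proof -
  have space: "space \<mu> = (\<Pi>\<^sub>E i\<in>I. UNIV)" using sets_eq_imp_space_eq[OF sets_mu] by (simp add: space_PiM)
  have [measurable_cong]: "sets \<mu> = sets (\<Pi>\<^sub>M i\<in>I. borel)" by fact
  let ?box = "\<lambda>(q, e). {w \<in> space \<mu>. \<forall>i\<in>I. \<bar>w i - q i\<bar> < (e::real)}"
  have box [measurable]: "?box p \<in> sets \<mu>" for p
    using I by (cases p) (simp, measurable)
  define D where "D = {p \<in> (\<Pi>\<^sub>E i\<in>I. \<rat>) \<times> \<rat>. emeasure \<mu> (?box p) = 0}"
  have "countable ((\<Pi>\<^sub>E i\<in>I. (\<rat> :: real set)) \<times> (\<rat> :: real set))"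
    using I by (intro countable_SIGMA countable_PiE countable_rat)
  then have D: "countable D" unfolding D_def by (rule countable_subset[rotated]) auto
  have null: "(\<Union>p\<in>D. ?box p) \<in> null_sets \<mu>"
    using D
  proof (rule null_sets_UN')
    fix p assume "p \<in> D"
    then show "?box p \<in> null_sets \<mu>" using box[of p] by (intro null_setsI) (auto simp: D_def)
  qed
  show ?thesis
  proof (rule AE_I'[OF null], safe)
    fix z assume z: "z \<in> space \<mu>" "z \<notin> measure_support I \<mu>"
    then obtain e where e: "e > 0" "emeasure \<mu> (?box (z, e)) = 0"
      by (auto simp: measure_support_def not_gr_zero)
    obtain e' where e': "e' \<in> \<rat>" "0 < e'" "e' < e / 2" using Rats_dense_in_real[of 0 "e / 2"] e by auto
    have "\<exists>r\<in>\<rat>. \<bar>z i - r\<bar> < e'" for i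
    proof -
      obtain r where "r \<in> \<rat>" "z i < r" "r < z i + e'"
        using Rats_dense_in_real[of "z i" "z i + e'"] e' by auto
      then show ?thesis by (intro bexI[of _ r]) auto
    qed
    then obtain q0 where q0: "\<And>i. q0 i \<in> \<rat>" "\<And>i. \<bar>z i - q0 i\<bar> < e'" by metis
    define q where "q = restrict q0 I"
    have "?box (q, e') \<subseteq> ?box (z, e)"
    proof safe
      fix w i assume "\<forall>i\<in>I. \<bar>w i - q i\<bar> < e'" "i \<in> I"
      then have "\<bar>w i - q0 i\<bar> < e'" by (auto simp: q_def)
      then show "\<bar>w i - z i\<bar> < e" using q0(2)[of i] e' by linarith
    qed
    then have "emeasure \<mu> (?box (q, e')) = 0"
      using emeasure_mono[OF _ box[of "(z, e)"], of "?box (q, e')"] e(2) by simp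
    then have "(q, e') \<in> D" using q0 e' by (auto simp: D_def q_def)
    moreover have "z \<in> ?box (q, e')" using z q0 by (auto simp: q_def)
    ultimately show "z \<in> (\<Union>p\<in>D. ?box p)" by blast
  qed
qed

text \<open>Countably many half-lines suffice, so that two kernels that agree almost everywhere on each
  half-line agree almost everywhere as measures.\<close>

lemma real_distribution_eqI_rational_cdf:
  assumes M: "real_distribution M" and N: "real_distribution N"
    and eq: "\<And>q. q \<in> \<rat> \<Longrightarrow> emeasure M {..q} = emeasure N {..q}"
  shows "M = N"
proof (rule cdf_unique[OF M N], rule ext)
  interpret M: real_distribution M by fact
  interpret N: real_distribution N by fact
  fix x
  have "((\<lambda>y. cdf M y - cdf N y) \<longlongrightarrow> cdf M x - cdf N x) (at_right x)"
    using M.cdf_is_right_cont N.cdf_is_right_cont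
    by (intro tendsto_diff) (simp_all add: continuous_within)
  moreover have "\<exists>\<^sub>F y in at_right x. cdf M y - cdf N y = 0"
    unfolding frequently_def eventually_at_right_field
  proof safe
    fix b assume b: "x < b" "\<forall>y>x. y < b \<longrightarrow> cdf M y - cdf N y \<noteq> 0"
    obtain q where "q \<in> \<rat>" "x < q" "q < b" using Rats_dense_in_real[OF b(1)] by blast
    with b eq[of q] show False by (auto simp: cdf_def measure_def)
  qed
  ultimately have "cdf M x - cdf N x = 0"
    by (metis (no_types, lifting) frequently_def tendsto_imp_eventually_ne eventually_mono)
  then show "cdf M x = cdf N x" by simp
qed

lemma tendsto_fun_componentwise:
  fixes f :: "'b \<Rightarrow> 'i \<Rightarrow> 'c::topological_space"
  assumes "\<And>i. ((\<lambda>n. f n i) \<longlongrightarrow> l i) F"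
  shows "(f \<longlongrightarrow> l) F"
proof -
  have "limitin (product_topology (\<lambda>_. euclidean) UNIV) f l F"
    using assms by (simp only: limitin_componentwise) simp
  then show ?thesis by (simp only: euclidean_product_topology limitin_canonical_iff)
qed

text \<open>The disintegration makes the kernels agree almost everywhere. Every neighbourhood of \<open>y\<close> has
  positive mass, so \<open>y\<close> is a limit of points of the support at which they agree; weak continuity
  along this sequence then yields agreement at \<open>y\<close> itself, although \<open>y\<close> may be a null point.\<close>

proposition cond_distr_unique_on_support:
  fixes Z :: "'w \<Rightarrow> 'i \<Rightarrow> real"
  assumes M: "prob_space M" and I: "finite I"
    and Z [measurable]: "Z \<in> M \<rightarrow>\<^sub>M (\<Pi>\<^sub>M i\<in>I. borel)"
    and k: "is_cond_distr M I Z X \<kappa>" and k': "is_cond_distr M I Z X \<kappa>'"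
    and y: "y \<in> measure_support I (distr M (\<Pi>\<^sub>M i\<in>I. borel) Z)"
  shows "\<kappa> y = \<kappa>' y"
proof -
  define \<mu> where "\<mu> = distr M (\<Pi>\<^sub>M i\<in>I. borel) Z"
  interpret M: prob_space M by fact
  interpret mu: prob_space \<mu> unfolding \<mu>_def by (rule M.prob_space_distr) measurable
  have sets_mu [measurable_cong, simp]: "sets \<mu> = sets (\<Pi>\<^sub>M i\<in>I. borel)" by (simp add: \<mu>_def)
  have space_mu: "space \<mu> = (\<Pi>\<^sub>E i\<in>I. UNIV)" using sets_eq_imp_space_eq[OF sets_mu] by (simp add: space_PiM)
  have kernel: "\<kappa> \<in> (\<Pi>\<^sub>M i\<in>I. borel) \<rightarrow>\<^sub>M prob_algebra borel" "\<kappa>' \<in> (\<Pi>\<^sub>M i\<in>I. borel) \<rightarrow>\<^sub>M prob_algebra borel"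
    using k k' unfolding is_cond_distr_def Let_def by blast+
  have disint: "(\<integral>\<^sup>+ z \<in> A. emeasure (\<kappa> z) B \<partial>\<mu>) = (\<integral>\<^sup>+ z \<in> A. emeasure (\<kappa>' z) B \<partial>\<mu>)"
    if "A \<in> sets \<mu>" "B \<in> sets borel" for A B
  proof -
    have "emeasure M {\<omega> \<in> space M. Z \<omega> \<in> A \<and> X \<omega> \<in> B} = (\<integral>\<^sup>+ z \<in> A. emeasure (\<kappa> z) B \<partial>\<mu>)"
      using k that unfolding is_cond_distr_def Let_def \<mu>_def[symmetric] sets_mu by blast
    moreover have "emeasure M {\<omega> \<in> space M. Z \<omega> \<in> A \<and> X \<omega> \<in> B} = (\<integral>\<^sup>+ z \<in> A. emeasure (\<kappa>' z) B \<partial>\<mu>)"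
      using k' that unfolding is_cond_distr_def Let_def \<mu>_def[symmetric] sets_mu by blast
    ultimately show ?thesis by simp
  qed
  have cont: "continuous_on (measure_support I \<mu>) (\<lambda>z. \<integral>t. h t \<partial>\<kappa> z)"
      "continuous_on (measure_support I \<mu>) (\<lambda>z. \<integral>t. h t \<partial>\<kappa>' z)"
    if "continuous_on UNIV h" "bounded (range h)" for h :: "real \<Rightarrow> real"
    using k k' that unfolding is_cond_distr_def Let_def \<mu>_def[symmetric] by blast+
  have distribution: "real_distribution (\<kappa> z)" "real_distribution (\<kappa>' z)" if "z \<in> space \<mu>" for z
    using measurable_space[OF kernel(1)] measurable_space[OF kernel(2)] that
    by (auto simp: \<mu>_def space_prob_algebra real_distribution_def real_distribution_axioms_def
        dest: sets_eq_imp_space_eq)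
  have "AE z in \<mu>. emeasure (\<kappa> z) B = emeasure (\<kappa>' z) B" if B: "B \<in> sets borel" for B
  proof (rule mu.density_unique_finite_measure)
    show "(\<lambda>z. emeasure (\<kappa> z) B) \<in> borel_measurable \<mu>" "(\<lambda>z. emeasure (\<kappa>' z) B) \<in> borel_measurable \<mu>"
      using measurable_prob_algebraD[OF kernel(1)] measurable_prob_algebraD[OF kernel(2)] B
      by (auto intro: measurable_emeasure_kernel simp: measurable_cong_sets[OF sets_mu refl])
  qed (use disint B in auto)
  then have "AE z in \<mu>. \<forall>q\<in>\<rat>. emeasure (\<kappa> z) {..q} = emeasure (\<kappa>' z) {..q}"
    by (subst AE_ball_countable) (auto intro: countable_rat)
  then have "AE z in \<mu>. \<kappa> z = \<kappa>' z \<and> z \<in> measure_support I \<mu>"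
    using AE_space AE_in_measure_support[OF I sets_mu]
  proof eventually_elim
    case (elim z)
    then show ?case using distribution by (auto intro: real_distribution_eqI_rational_cdf)
  qed
  then obtain N where N: "N \<in> null_sets \<mu>"
    "{z \<in> space \<mu>. \<not> (\<kappa> z = \<kappa>' z \<and> z \<in> measure_support I \<mu>)} \<subseteq> N"
    unfolding eventually_ae_filter by blast
  have y_space: "y \<in> space \<mu>" and y_pos: "\<And>e. e > 0 \<Longrightarrow> 0 < emeasure \<mu> {w \<in> space \<mu>. \<forall>i\<in>I. \<bar>w i - y i\<bar> < e}"
    using y unfolding measure_support_def \<mu>_def[symmetric] by auto
  have "\<exists>z. z \<in> space \<mu> \<and> (\<forall>i\<in>I. \<bar>z i - y i\<bar> < 1 / real (Suc n)) \<and> \<kappa> z = \<kappa>' z \<and> z \<in> measure_support I \<mu>" for n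
  proof (rule ccontr)
    assume "\<not> ?thesis"
    then have "{w \<in> space \<mu>. \<forall>i\<in>I. \<bar>w i - y i\<bar> < 1 / real (Suc n)} \<subseteq> N" using N(2) by blast
    then have "emeasure \<mu> {w \<in> space \<mu>. \<forall>i\<in>I. \<bar>w i - y i\<bar> < 1 / real (Suc n)} \<le> emeasure \<mu> N"
      using N(1) by (intro emeasure_mono) auto
    then show False using N(1) y_pos[of "1 / real (Suc n)"] by (simp add: null_setsD1)
  qed
  then obtain z where z: "\<And>n. z n \<in> space \<mu>" "\<And>n i. i \<in> I \<Longrightarrow> \<bar>z n i - y i\<bar> < 1 / real (Suc n)"
    "\<And>n. \<kappa> (z n) = \<kappa>' (z n)" "\<And>n. z n \<in> measure_support I \<mu>" by metis
  have lim: "z \<longlonglongrightarrow> y"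
  proof (rule tendsto_fun_componentwise)
    fix i
    show "(\<lambda>n. z n i) \<longlonglongrightarrow> y i"
    proof (cases "i \<in> I")
      case True
      have "(\<lambda>n. z n i - y i) \<longlonglongrightarrow> 0"
        by (rule Lim_null_comparison[OF _ LIMSEQ_Suc[OF lim_1_over_n]])
          (use z(2)[OF True] in \<open>auto intro!: eventuallyI less_imp_le\<close>)
      then show ?thesis by (simp add: LIM_zero_iff)
    next
      case False
      then have "z n i = y i" for n
        using z(1)[of n] y_space unfolding space_mu by (auto simp: PiE_def extensional_def)
      then show ?thesis by simp
    qed
  qed
  have weak: "(\<integral>t. h t \<partial>\<kappa> y) = (\<integral>t. h t \<partial>\<kappa>' y)" if h: "continuous_on UNIV h" "bounded (range h)" for h :: "real \<Rightarrow> real"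
  proof -
    have y': "y \<in> measure_support I \<mu>" using y by (simp add: \<mu>_def)
    have "(\<lambda>n. \<integral>t. h t \<partial>\<kappa> (z n)) \<longlonglongrightarrow> (\<integral>t. h t \<partial>\<kappa> y)" "(\<lambda>n. \<integral>t. h t \<partial>\<kappa>' (z n)) \<longlonglongrightarrow> (\<integral>t. h t \<partial>\<kappa>' y)"
      using continuous_on_tendsto_compose[OF cont(1)[OF h] lim y'] continuous_on_tendsto_compose[OF cont(2)[OF h] lim y'] z(4)
      by auto
    then show ?thesis using LIMSEQ_unique z(3) by simp
  qed
  interpret ky: real_distribution "\<kappa> y" using distribution y_space by blast
  interpret ky': real_distribution "\<kappa>' y" using distribution y_space by blast
  show ?thesis
    by (rule real_measure_eqI_cos)
      (auto intro!: weak continuous_intros boundedI[of _ 1] ky.finite_measure_axioms ky'.finite_measure_axioms)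
qed

section \<open>Isonormal processes\<close>

lemma centred_gaussian_scaled_standard:
  assumes "prob_space M" and X: "centred_gaussian M X v" and v: "v \<noteq> 0"
  shows "0 < v" "distr M lborel (\<lambda>\<omega>. X \<omega> / sqrt v) = std_normal_distribution"
proof -
  interpret prob_space M by fact
  show "0 < v" using X v by (simp add: centred_gaussian_def)
  then have "distributed M lborel (\<lambda>\<omega>. (X \<omega> - 0) / sqrt v) std_normal_density"
    using X v by (subst normal_standard_normal_convert[symmetric]) (auto simp: centred_gaussian_def)
  then show "distr M lborel (\<lambda>\<omega>. X \<omega> / sqrt v) = std_normal_distribution"
    by (simp add: distributed_def)
qed

lemma centred_gaussian_trig:
  assumes M: "prob_space M" and X: "centred_gaussian M X v"
  shows "(\<integral>\<omega>. cos (X \<omega> + \<theta>) \<partial>M) = cos \<theta> * exp (- v / 2)"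
    and "(\<integral>\<omega>. sin (X \<omega> + \<theta>) \<partial>M) = sin \<theta> * exp (- v / 2)"
proof -
  interpret prob_space M by fact
  have [measurable]: "X \<in> borel_measurable M" using X by (simp add: centred_gaussian_def)
  have "(\<integral>\<omega>. cos (X \<omega>) \<partial>M) = exp (- v / 2) \<and> (\<integral>\<omega>. sin (X \<omega>) \<partial>M) = 0"
  proof (cases "v = 0")
    case True
    then have "AE \<omega> in M. X \<omega> = 0" using X by (simp add: centred_gaussian_def)
    then have "AE \<omega> in M. cos (X \<omega>) = 1" "AE \<omega> in M. sin (X \<omega>) = 0"
      by (auto elim: eventually_mono)
    then have "(\<integral>\<omega>. cos (X \<omega>) \<partial>M) = (\<integral>\<omega>. 1 \<partial>M)" "(\<integral>\<omega>. sin (X \<omega>) \<partial>M) = (\<integral>\<omega>. 0 \<partial>M)"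
      by (intro integral_cong_AE; simp)+
    then show ?thesis using True by (simp add: prob_space)
  next
    case False
    note std = centred_gaussian_scaled_standard[OF M X False]
    interpret N: real_distribution std_normal_distribution by (rule real_dist_normal_dist)
    have int: "integrable std_normal_distribution (\<lambda>x. iexp (sqrt v * x))"
      using N.integrable_iexp[of "\<lambda>x. complex_of_real (sqrt v * x)"] by simp
    have c: "char std_normal_distribution (sqrt v) = complex_of_real (exp (- v / 2))"
      using std(1) by (simp add: char_std_normal_distribution)
    have "(\<integral>x. cos (sqrt v * x) \<partial>std_normal_distribution) = exp (- v / 2)"
      using arg_cong[OF c, of Re] unfolding char_def
      by (subst (asm) integral_Re[OF int, symmetric]) (simp add: Re_exp)
    moreover have "(\<integral>x. sin (sqrt v * x) \<partial>std_normal_distribution) = 0"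
      using arg_cong[OF c, of Im] unfolding char_def
      by (subst (asm) integral_Im[OF int, symmetric]) (simp add: Im_exp)
    ultimately show ?thesis
      using std(1) unfolding std(2)[symmetric] by (simp add: integral_distr)
  qed
  moreover have "integrable M (\<lambda>\<omega>. cos (X \<omega>))" "integrable M (\<lambda>\<omega>. sin (X \<omega>))"
    by (auto intro!: integrable_bounded_finite[OF finite_measure_axioms, where B=1])
  ultimately show "(\<integral>\<omega>. cos (X \<omega> + \<theta>) \<partial>M) = cos \<theta> * exp (- v / 2)"
    and "(\<integral>\<omega>. sin (X \<omega> + \<theta>) \<partial>M) = sin \<theta> * exp (- v / 2)"
    by (simp_all add: cos_add sin_add)
qed

lemma centred_gaussian_expectation:
  assumes M: "prob_space M" and X: "centred_gaussian M X v"
  shows "integrable M X" "(\<integral>\<omega>. X \<omega> \<partial>M) = 0"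
proof -
  interpret prob_space M by fact
  have [measurable]: "X \<in> borel_measurable M" using X by (simp add: centred_gaussian_def)
  have "integrable M X \<and> (\<integral>\<omega>. X \<omega> \<partial>M) = 0"
  proof (cases "v = 0")
    case True
    then have "AE \<omega> in M. X \<omega> = 0" using X by (simp add: centred_gaussian_def)
    then show ?thesis using integrable_cong_AE[of X M "\<lambda>_. 0"] integral_cong_AE[of X M "\<lambda>_. 0"] by simp
  next
    case False
    note std = centred_gaussian_scaled_standard[OF M X False]
    have int: "integrable std_normal_distribution (\<lambda>x. x)"
      using integrable_std_normal_distribution_moment[of 1] by simp
    have "(\<integral>x. x \<partial>std_normal_distribution) = 0"
      using integral_std_normal_distribution_moment_odd[of 1] by simp
    with int have *: "integrable M (\<lambda>\<omega>. X \<omega> / sqrt v)" "(\<integral>\<omega>. X \<omega> / sqrt v \<partial>M) = 0"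
      unfolding std(2)[symmetric] by (simp_all add: integral_distr integrable_distr_eq)
    then have "integrable M (\<lambda>\<omega>. sqrt v * (X \<omega> / sqrt v))" by (intro integrable_mult_right)
    then show ?thesis using std(1) * by simp
  qed
  then show "integrable M X" "(\<integral>\<omega>. X \<omega> \<partial>M) = 0" by auto
qed

lemma centred_gaussian_near_pos:
  assumes M: "prob_space M" and X: "centred_gaussian M X v" and "v \<noteq> 0" and e: "0 < e"
  shows "0 < emeasure M {\<omega> \<in> space M. \<bar>X \<omega> - m\<bar> < e}"
proof -
  interpret prob_space M by fact
  have [measurable]: "X \<in> borel_measurable M" using X by (simp add: centred_gaussian_def)
  have v: "0 < v" and D: "distributed M lborel X (\<lambda>t. ennreal (normal_density 0 (sqrt v) t))"
    using X \<open>v \<noteq> 0\<close> by (auto simp: centred_gaussian_def)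
  have "emeasure M {\<omega> \<in> space M. \<bar>X \<omega> - m\<bar> < e} = emeasure M (X -` {m - e<..<m + e} \<inter> space M)"
    by (rule arg_cong[where f="emeasure M"]) auto
  also have "\<dots> = (\<integral>\<^sup>+t. ennreal (normal_density 0 (sqrt v) t) * indicator {m - e<..<m + e} t \<partial>lborel)"
    by (rule distributed_emeasure[OF D]) simp
  also have "\<dots> \<noteq> 0"
  proof
    assume "(\<integral>\<^sup>+t. ennreal (normal_density 0 (sqrt v) t) * indicator {m - e<..<m + e} t \<partial>lborel) = 0"
    then have "AE t in lborel. ennreal (normal_density 0 (sqrt v) t) * indicator {m - e<..<m + e} t = 0"
      by (subst (asm) nn_integral_0_iff_AE) auto
    then have "AE t in lborel. t \<notin> {m - e<..<m + e}"
    proof (rule eventually_mono)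
      fix t assume "ennreal (normal_density 0 (sqrt v) t) * indicator {m - e<..<m + e} t = 0"
      moreover have "ennreal (normal_density 0 (sqrt v) t) \<noteq> 0"
        using normal_density_pos[of "sqrt v" 0 t] v by simp
      ultimately show "t \<notin> {m - e<..<m + e}" by (simp add: indicator_eq_0_iff)
    qed
    then have "emeasure lborel {m - e<..<m + e} = 0" 
      using AE_iff_measurable[of "{m - e<..<m + e}" lborel "\<lambda>t. t \<notin> {m - e<..<m + e}"]
      by (simp del: greaterThanLessThan_iff)
    then show False using e by simp
  qed
  finally show ?thesis by (simp add: zero_less_iff_neq_zero)
qed

text \<open>The Gaussian field, indexed by the Riesz representers of the functionals: covariances become inner
  products of \<open>U\<close>, and orthogonality in \<open>U\<close> becomes independence.\<close>

locale isonormal_process = hilbert_functions S U ip + prob_space M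
  for S :: "'a set" and U ip and M :: "'w measure" +
  fixes W :: "('a \<Rightarrow> real) \<Rightarrow> 'w \<Rightarrow> real"
  assumes gaussian: "r \<in> U \<Longrightarrow> centred_gaussian M (W r) (ip r r)"
    and linear: "r \<in> U \<Longrightarrow> s \<in> U \<Longrightarrow> AE \<omega> in M. W (\<lambda>x. a * r x + b * s x) \<omega> = a * W r \<omega> + b * W s \<omega>"
begin

lemma W_measurable [measurable (raw)]: "r \<in> U \<Longrightarrow> W r \<in> borel_measurable M"
  using gaussian by (simp add: centred_gaussian_def)

lemma W_sum:
  assumes "finite I" "\<And>i. i \<in> I \<Longrightarrow> r i \<in> U"
  shows "AE \<omega> in M. W (\<lambda>x. \<Sum>i\<in>I. c i * r i x) \<omega> = (\<Sum>i\<in>I. c i * W (r i) \<omega>)"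
  using assms
proof (induction I rule: finite_induct)
  case empty
  show ?case using linear[OF zero_mem zero_mem, of 0 0] by simp
next
  case (insert k I)
  have "AE \<omega> in M. W (\<lambda>x. \<Sum>i\<in>I. c i * r i x) \<omega> = (\<Sum>i\<in>I. c i * W (r i) \<omega>)"
    using insert by simp
  moreover have "AE \<omega> in M. W (\<lambda>x. c k * r k x + 1 * (\<Sum>i\<in>I. c i * r i x)) \<omega>
    = c k * W (r k) \<omega> + 1 * W (\<lambda>x. \<Sum>i\<in>I. c i * r i x) \<omega>"
    using insert by (intro linear sum_mem) auto
  ultimately show ?case
  proof eventually_elim
    case (elim \<omega>)
    then show ?case using insert.hyps by simp
  qed
qed

text \<open>A linear combination of values of \<open>W\<close> is again a value of \<open>W\<close>, so its cosine transform is known, and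
  for orthogonal arguments the squared norm in the exponent is a sum of two terms.\<close>

lemma W_orthogonal_independent:
  assumes I: "finite I" and r: "\<And>i. i \<in> I \<Longrightarrow> r i \<in> U" and g: "g \<in> U"
    and orth: "\<And>i. i \<in> I \<Longrightarrow> ip g (r i) = 0"
  shows "distr M (borel \<Otimes>\<^sub>M (\<Pi>\<^sub>M i\<in>I. borel)) (\<lambda>\<omega>. (W g \<omega>, \<lambda>i\<in>I. W (r i) \<omega>))
    = distr M borel (W g) \<Otimes>\<^sub>M distr M (\<Pi>\<^sub>M i\<in>I. borel) (\<lambda>\<omega>. \<lambda>i\<in>I. W (r i) \<omega>)"
proof (rule distr_Pair_eq_pair_measureI_cos[OF W_measurable[OF g] W_measurable[OF r] I])
  fix s t \<theta>
  define q where "q = (\<lambda>x. \<Sum>i\<in>I. t i * r i x)"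
  have q: "q \<in> U" unfolding q_def by (intro sum_mem r)
  have [measurable]: "W g \<in> borel_measurable M" "\<And>i. i \<in> I \<Longrightarrow> W (r i) \<in> borel_measurable M"
    using g r by auto
  have "ip q g = 0" unfolding q_def using orth r g by (simp add: ip_sum ip_sym[of _ g])
  then have "ip g q = 0" using ip_sym g q by simp
  then have norm: "ip (\<lambda>x. s * g x + 1 * q x) (\<lambda>x. s * g x + 1 * q x) = s\<^sup>2 * ip g g + ip q q"
    by (simp only: ip_lin_self[OF g q]) simp
  have Wq: "AE \<omega> in M. W q \<omega> = (\<Sum>i\<in>I. t i * W (r i) \<omega>)"
    unfolding q_def using I r by (rule W_sum)
  have Ws: "AE \<omega> in M. W (\<lambda>x. s * g x + 0 * g x) \<omega> = s * W g \<omega> + 0 * W g \<omega>" by (rule linear[OF g g])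
  have Wsum: "AE \<omega> in M. W (\<lambda>x. s * g x + 1 * q x) \<omega> = s * W g \<omega> + 1 * W q \<omega>" by (rule linear[OF g q])
  have sg: "(\<lambda>x. s * g x + 0 * g x) \<in> U" "(\<lambda>x. s * g x + 1 * q x) \<in> U" by (intro lin_mem g q)+
  have nsg: "ip (\<lambda>x. s * g x + 0 * g x) (\<lambda>x. s * g x + 0 * g x) = s\<^sup>2 * ip g g"
    by (simp only: ip_lin_self[OF g g]) simp
  have "expectation (\<lambda>\<omega>. cos (s * W g \<omega> + (\<Sum>i\<in>I. t i * W (r i) \<omega>) + \<theta>))
    = expectation (\<lambda>\<omega>. cos (W (\<lambda>x. s * g x + 1 * q x) \<omega> + \<theta>))"
    using Wq Wsum sg by (intro integral_cong_AE) auto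
  also have "\<dots> = cos \<theta> * exp (- (s\<^sup>2 * ip g g + ip q q) / 2)"
    using centred_gaussian_trig(1)[OF prob_space_axioms gaussian[OF sg(2)]] by (simp only: norm)
  finally have lhs: "expectation (\<lambda>\<omega>. cos (s * W g \<omega> + (\<Sum>i\<in>I. t i * W (r i) \<omega>) + \<theta>)) = \<dots>" .
  have "expectation (\<lambda>\<omega>. cos (s * W g \<omega>)) = expectation (\<lambda>\<omega>. cos (W (\<lambda>x. s * g x + 0 * g x) \<omega> + 0))"
    using Ws sg by (intro integral_cong_AE) auto
  also have "\<dots> = exp (- (s\<^sup>2 * ip g g) / 2)"
    using centred_gaussian_trig(1)[OF prob_space_axioms gaussian[OF sg(1)]] by (simp only: nsg) simp
  finally have rhs1: "expectation (\<lambda>\<omega>. cos (s * W g \<omega>)) = \<dots>" .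
  have "expectation (\<lambda>\<omega>. sin (s * W g \<omega>)) = expectation (\<lambda>\<omega>. sin (W (\<lambda>x. s * g x + 0 * g x) \<omega> + 0))"
    using Ws sg by (intro integral_cong_AE) auto
  also have "\<dots> = 0"
    using centred_gaussian_trig(2)[OF prob_space_axioms gaussian[OF sg(1)], of 0] by (simp only: sin_zero mult_zero_left)
  finally have rhs2: "expectation (\<lambda>\<omega>. sin (s * W g \<omega>)) = 0" .
  have "expectation (\<lambda>\<omega>. cos ((\<Sum>i\<in>I. t i * W (r i) \<omega>) + \<theta>)) = expectation (\<lambda>\<omega>. cos (W q \<omega> + \<theta>))"
    using Wq q by (intro integral_cong_AE) auto
  also have "\<dots> = cos \<theta> * exp (- ip q q / 2)"
    by (rule centred_gaussian_trig(1)[OF prob_space_axioms gaussian[OF q]])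
  finally have rhs3: "expectation (\<lambda>\<omega>. cos ((\<Sum>i\<in>I. t i * W (r i) \<omega>) + \<theta>)) = \<dots>" .
  show "expectation (\<lambda>\<omega>. cos (s * W g \<omega> + (\<Sum>i\<in>I. t i * W (r i) \<omega>) + \<theta>))
    = expectation (\<lambda>\<omega>. cos (s * W g \<omega>)) * expectation (\<lambda>\<omega>. cos ((\<Sum>i\<in>I. t i * W (r i) \<omega>) + \<theta>))
    - expectation (\<lambda>\<omega>. sin (s * W g \<omega>)) * expectation (\<lambda>\<omega>. sin ((\<Sum>i\<in>I. t i * W (r i) \<omega>) + \<theta>))"
    unfolding lhs rhs1 rhs2 rhs3 by (simp add: add_divide_distrib diff_divide_distrib flip: exp_add)
qed

text \<open>The vector of the values \<open>\<langle>g, r\<^sub>i\<rangle>\<close> lies in the support of the Gaussian vector \<open>W r\<^sub>i\<close>, even if its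
  covariance is singular. Replacing each \<open>r\<^sub>i\<close> by its component \<open>s\<^sub>i\<close> orthogonal to \<open>r\<^sub>k\<close> makes \<open>W r\<^sub>k\<close>
  independent of the vector of the \<open>W s\<^sub>i\<close>; both are near their targets with positive probability, the
  first by positivity of the normal density, the second by induction.\<close>

lemma W_near_pos:
  assumes "finite I" "\<And>i. i \<in> I \<Longrightarrow> r i \<in> U" "g \<in> U" "0 < e"
  shows "0 < emeasure M {\<omega> \<in> space M. \<forall>i\<in>I. \<bar>W (r i) \<omega> - ip g (r i)\<bar> < e}"
  using assms
proof (induction I arbitrary: r e rule: finite_induct)
  case empty
  then show ?case by (simp add: emeasure_space_1)
next
  case (insert k I)
  have rk: "r k \<in> U" and rI: "\<And>i. i \<in> I \<Longrightarrow> r i \<in> U" using insert.prems by auto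
  have [measurable]: "W (r k) \<in> borel_measurable M" "\<And>i. i \<in> I \<Longrightarrow> W (r i) \<in> borel_measurable M"
    using rk rI by auto
  note [measurable] = \<open>finite I\<close>
  show ?case
  proof (cases "ip (r k) (r k) = 0")
    case True
    then have "AE \<omega> in M. W (r k) \<omega> = 0" using gaussian[OF rk] by (simp add: centred_gaussian_def)
    moreover have "ip g (r k) = 0"
      using ip_eq_0[OF rk True] ip_zero[OF \<open>g \<in> U\<close>] ip_sym[OF \<open>g \<in> U\<close> zero_mem] by simp
    ultimately have "emeasure M {\<omega> \<in> space M. \<forall>i\<in>insert k I. \<bar>W (r i) \<omega> - ip g (r i)\<bar> < e}
      = emeasure M {\<omega> \<in> space M. \<forall>i\<in>I. \<bar>W (r i) \<omega> - ip g (r i)\<bar> < e}"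
      using \<open>0 < e\<close> \<open>finite I\<close> by (intro emeasure_eq_AE) auto
    then show ?thesis using insert.IH[OF rI \<open>g \<in> U\<close> \<open>0 < e\<close>] by simp
  next
    case False
    define l where "l = (\<lambda>i. ip (r i) (r k) / ip (r k) (r k))"
    define s where "s = (\<lambda>i x. 1 * r i x + (- l i) * r k x)"
    have s: "s i \<in> U" if "i \<in> I" for i unfolding s_def by (intro lin_mem rI that rk)
    have orth: "ip (r k) (s i) = 0" if "i \<in> I" for i
    proof -
      have "ip (s i) (r k) = 0"
        unfolding s_def l_def using False by (simp only: ip_lin[OF rI[OF that] rk rk]) simp
      then show ?thesis using ip_sym s that rk by simp
    qed
    have Ws: "AE \<omega> in M. \<forall>i\<in>I. W (s i) \<omega> = 1 * W (r i) \<omega> + (- l i) * W (r k) \<omega>"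
      unfolding s_def using \<open>finite I\<close> by (intro AE_ball_countable' linear rI rk countable_finite)
    have ip_s: "ip g (s i) = ip g (r i) - l i * ip g (r k)" if "i \<in> I" for i
    proof -
      have "ip (s i) g = 1 * ip (r i) g + (- l i) * ip (r k) g"
        unfolding s_def by (rule ip_lin[OF rI[OF that] rk \<open>g \<in> U\<close>])
      then show ?thesis using ip_sym[OF \<open>g \<in> U\<close>] s rI rk that by simp
    qed
    \<comment> \<open>\<open>W r\<^sub>k\<close> enters \<open>W r\<^sub>i\<close> with the factor \<open>l i\<close>, at most \<open>C\<close> in absolute value, so the tolerance \<open>d\<close>
      for it contributes at most \<open>e / 2\<close>.\<close>
    define C where "C = 1 + (\<Sum>i\<in>I. \<bar>l i\<bar>)"
    have C: "1 \<le> C" "\<And>i. i \<in> I \<Longrightarrow> \<bar>l i\<bar> \<le> C"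
      unfolding C_def using \<open>finite I\<close> member_le_sum[of _ I "\<lambda>i. \<bar>l i\<bar>"] by (auto simp: sum_nonneg add_increasing)
    define d where "d = e / (2 * C)"
    have d: "0 < d" "C * d = e / 2" "d \<le> e / 2"
      using C(1) \<open>0 < e\<close> by (auto simp: d_def field_simps)
    have [measurable]: "\<And>i. i \<in> I \<Longrightarrow> W (s i) \<in> borel_measurable M" using s by auto
    define A where "A = {y :: real. \<bar>y - ip g (r k)\<bar> < d}"
    define B where "B = {z \<in> space (\<Pi>\<^sub>M i\<in>I. borel). \<forall>i\<in>I. \<bar>z i - ip g (s i)\<bar> < e / 2}"
    have A [measurable]: "A \<in> sets borel" unfolding A_def by measurable
    have B [measurable]: "B \<in> sets (\<Pi>\<^sub>M i\<in>I. borel)" unfolding B_def by measurable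
    have mZ [measurable]: "(\<lambda>\<omega>. \<lambda>i\<in>I. W (s i) \<omega>) \<in> M \<rightarrow>\<^sub>M (\<Pi>\<^sub>M i\<in>I. borel)"
      by (intro measurable_restrict) measurable
    have pre_B: "(\<lambda>i\<in>I. W (s i) \<omega>) \<in> B \<longleftrightarrow> (\<forall>i\<in>I. \<bar>W (s i) \<omega> - ip g (s i)\<bar> < e / 2)" for \<omega>
      by (auto simp: B_def space_PiM)
    interpret DZ: prob_space "distr M (\<Pi>\<^sub>M i\<in>I. borel) (\<lambda>\<omega>. \<lambda>i\<in>I. W (s i) \<omega>)"
      by (rule prob_space_distr) measurable
    have indep: "distr M (borel \<Otimes>\<^sub>M (\<Pi>\<^sub>M i\<in>I. borel)) (\<lambda>\<omega>. (W (r k) \<omega>, \<lambda>i\<in>I. W (s i) \<omega>))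
      = distr M borel (W (r k)) \<Otimes>\<^sub>M distr M (\<Pi>\<^sub>M i\<in>I. borel) (\<lambda>\<omega>. \<lambda>i\<in>I. W (s i) \<omega>)"
      using \<open>finite I\<close> s rk orth by (rule W_orthogonal_independent)
    have pos_A: "emeasure (distr M borel (W (r k))) A = emeasure M {\<omega> \<in> space M. \<bar>W (r k) \<omega> - ip g (r k)\<bar> < d}"
      by (subst emeasure_distr, measurable) (auto simp: A_def intro!: arg_cong[where f="emeasure M"])
    have pos_B: "emeasure (distr M (\<Pi>\<^sub>M i\<in>I. borel) (\<lambda>\<omega>. \<lambda>i\<in>I. W (s i) \<omega>)) B
      = emeasure M {\<omega> \<in> space M. \<forall>i\<in>I. \<bar>W (s i) \<omega> - ip g (s i)\<bar> < e / 2}"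
    proof -
      have "emeasure (distr M (\<Pi>\<^sub>M i\<in>I. borel) (\<lambda>\<omega>. \<lambda>i\<in>I. W (s i) \<omega>)) B = emeasure M ((\<lambda>\<omega>. \<lambda>i\<in>I. W (s i) \<omega>) -` B \<inter> space M)"
        by (rule emeasure_distr[OF mZ B])
      also have "(\<lambda>\<omega>. \<lambda>i\<in>I. W (s i) \<omega>) -` B \<inter> space M = {\<omega> \<in> space M. \<forall>i\<in>I. \<bar>W (s i) \<omega> - ip g (s i)\<bar> < e / 2}"
        using pre_B by blast
      finally show ?thesis .
    qed
    have "0 < emeasure M {\<omega> \<in> space M. \<bar>W (r k) \<omega> - ip g (r k)\<bar> < d}"
      by (rule centred_gaussian_near_pos[OF prob_space_axioms gaussian[OF rk] False d(1)])
    moreover have "0 < emeasure M {\<omega> \<in> space M. \<forall>i\<in>I. \<bar>W (s i) \<omega> - ip g (s i)\<bar> < e / 2}"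
      using insert.IH[of s "e / 2"] s \<open>g \<in> U\<close> \<open>0 < e\<close> by simp
    ultimately have "0 < emeasure (distr M borel (W (r k))) A * emeasure (distr M (\<Pi>\<^sub>M i\<in>I. borel) (\<lambda>\<omega>. \<lambda>i\<in>I. W (s i) \<omega>)) B"
      unfolding pos_A pos_B by (simp add: ennreal_zero_less_mult_iff)
    also have "\<dots> = emeasure (distr M borel (W (r k)) \<Otimes>\<^sub>M distr M (\<Pi>\<^sub>M i\<in>I. borel) (\<lambda>\<omega>. \<lambda>i\<in>I. W (s i) \<omega>)) (A \<times> B)"
      by (rule DZ.emeasure_pair_measure_Times[symmetric]) (use A B in simp_all)
    also have "\<dots> = emeasure (distr M (borel \<Otimes>\<^sub>M (\<Pi>\<^sub>M i\<in>I. borel)) (\<lambda>\<omega>. (W (r k) \<omega>, \<lambda>i\<in>I. W (s i) \<omega>))) (A \<times> B)"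
      unfolding indep ..
    also have "\<dots> = emeasure M ((\<lambda>\<omega>. (W (r k) \<omega>, \<lambda>i\<in>I. W (s i) \<omega>)) -` (A \<times> B) \<inter> space M)"
      by (rule emeasure_distr) measurable
    also have "(\<lambda>\<omega>. (W (r k) \<omega>, \<lambda>i\<in>I. W (s i) \<omega>)) -` (A \<times> B) \<inter> space M
      = {\<omega> \<in> space M. \<bar>W (r k) \<omega> - ip g (r k)\<bar> < d \<and> (\<forall>i\<in>I. \<bar>W (s i) \<omega> - ip g (s i)\<bar> < e / 2)}"
      using pre_B unfolding A_def by blast
    also have "emeasure M {\<omega> \<in> space M. \<bar>W (r k) \<omega> - ip g (r k)\<bar> < d \<and> (\<forall>i\<in>I. \<bar>W (s i) \<omega> - ip g (s i)\<bar> < e / 2)}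
      \<le> emeasure M {\<omega> \<in> space M. \<forall>i\<in>insert k I. \<bar>W (r i) \<omega> - ip g (r i)\<bar> < e}"
    proof (rule emeasure_mono_AE)
      show "AE \<omega> in M. \<omega> \<in> {\<omega> \<in> space M. \<bar>W (r k) \<omega> - ip g (r k)\<bar> < d \<and> (\<forall>i\<in>I. \<bar>W (s i) \<omega> - ip g (s i)\<bar> < e / 2)}
        \<longrightarrow> \<omega> \<in> {\<omega> \<in> space M. \<forall>i\<in>insert k I. \<bar>W (r i) \<omega> - ip g (r i)\<bar> < e}"
        using Ws
      proof eventually_elim
        case (elim \<omega>)
        show ?case
        proof safe
          fix i assume *: "\<bar>W (r k) \<omega> - ip g (r k)\<bar> < d" "\<forall>i\<in>I. \<bar>W (s i) \<omega> - ip g (s i)\<bar> < e / 2" and i: "i \<in> I"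
          have "W (r i) \<omega> - ip g (r i) = (W (s i) \<omega> - ip g (s i)) + l i * (W (r k) \<omega> - ip g (r k))"
            using elim i by (simp add: ip_s algebra_simps)
          also have "\<bar>\<dots>\<bar> \<le> \<bar>W (s i) \<omega> - ip g (s i)\<bar> + \<bar>l i * (W (r k) \<omega> - ip g (r k))\<bar>" by linarith
          also have "\<bar>l i * (W (r k) \<omega> - ip g (r k))\<bar> \<le> C * d"
            unfolding abs_mult using * C i by (intro mult_mono) auto
          finally show "\<bar>W (r i) \<omega> - ip g (r i)\<bar> < e" using * i d(2) by auto
        qed (use d \<open>0 < e\<close> in auto)
      qed
      show "{\<omega> \<in> space M. \<forall>i\<in>insert k I. \<bar>W (r i) \<omega> - ip g (r i)\<bar> < e} \<in> events"
      proof (intro sets.sets_Collect_finite_All')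
        fix i assume "i \<in> insert k I"
        then have [measurable]: "W (r i) \<in> borel_measurable M" using insert.prems(1) by simp
        show "{\<omega> \<in> space M. \<bar>W (r i) \<omega> - ip g (r i)\<bar> < e} \<in> events" by measurable
      qed (use \<open>finite I\<close> in auto)
    qed
    finally show ?thesis .
  qed
qed

text \<open>Split \<open>h = q + \<Sum> c\<^sub>i r\<^sub>i\<close> with \<open>q\<close> orthogonal to all \<open>r\<^sub>i\<close>. Then \<open>W q\<close> is independent of the \<open>W r\<^sub>i\<close>, so
  given \<open>W r\<^sub>i = z\<^sub>i\<close> the conditional law of \<open>W h\<close> is the law of \<open>W q\<close> shifted by \<open>\<Sum> c\<^sub>i z\<^sub>i\<close>. It depends
  weakly continuously on \<open>z\<close> because the shift is continuous in \<open>z\<close>.\<close>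

lemma W_cond_distr:
  assumes I: "finite I" and r: "\<And>i. i \<in> I \<Longrightarrow> r i \<in> U" and h: "h \<in> U"
    and orth: "\<And>k. k \<in> I \<Longrightarrow> ip (\<lambda>x. h x - (\<Sum>i\<in>I. c i * r i x)) (r k) = 0"
  shows "\<exists>\<kappa>. is_cond_distr M I (\<lambda>\<omega>. \<lambda>i\<in>I. W (r i) \<omega>) (W h) \<kappa> \<and>
    (\<forall>z. integrable (\<kappa> z) (\<lambda>t. t) \<and> (\<integral>t. t \<partial>\<kappa> z) = (\<Sum>i\<in>I. c i * z i))"
proof -
  define p where "p = (\<lambda>x. \<Sum>i\<in>I. c i * r i x)"
  define q where "q = (\<lambda>x. 1 * h x + (- 1) * p x)"
  have p: "p \<in> U" unfolding p_def by (intro sum_mem r)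
  have q: "q \<in> U" unfolding q_def by (intro lin_mem h p)
  have qr: "ip q (r k) = 0" if "k \<in> I" for k using orth[OF that] by (simp add: q_def p_def)
  define \<nu> where "\<nu> = distr M borel (W q)"
  define \<mu> where "\<mu> = distr M (\<Pi>\<^sub>M i\<in>I. borel) (\<lambda>\<omega>. \<lambda>i\<in>I. W (r i) \<omega>)"
  define \<kappa> where "\<kappa> = (\<lambda>z. distr \<nu> borel (\<lambda>y. y + (\<Sum>i\<in>I. c i * z i)))"
  have [measurable]: "W q \<in> borel_measurable M" "W h \<in> borel_measurable M" "\<And>i. i \<in> I \<Longrightarrow> W (r i) \<in> borel_measurable M"
    using q h r by auto
  have mZ [measurable]: "(\<lambda>\<omega>. \<lambda>i\<in>I. W (r i) \<omega>) \<in> M \<rightarrow>\<^sub>M (\<Pi>\<^sub>M i\<in>I. borel)"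
    by (intro measurable_restrict) measurable
  have [measurable_cong, simp]: "sets \<nu> = sets borel" "sets \<mu> = sets (\<Pi>\<^sub>M i\<in>I. borel)"
    by (simp_all add: \<nu>_def \<mu>_def)
  interpret nu: prob_space \<nu> unfolding \<nu>_def by (rule prob_space_distr) measurable
  interpret mu: prob_space \<mu> unfolding \<mu>_def by (rule prob_space_distr) measurable
  interpret P: pair_prob_space \<nu> \<mu> ..
  have Wh: "AE \<omega> in M. W h \<omega> = W q \<omega> + (\<Sum>i\<in>I. c i * W (r i) \<omega>)"
  proof -
    have "AE \<omega> in M. W p \<omega> = (\<Sum>i\<in>I. c i * W (r i) \<omega>)" unfolding p_def by (rule W_sum[OF I r])
    moreover have "AE \<omega> in M. W q \<omega> = 1 * W h \<omega> + (- 1) * W p \<omega>" unfolding q_def by (rule linear[OF h p])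
    ultimately show ?thesis by eventually_elim simp
  qed
  have kernel: "\<kappa> \<in> (\<Pi>\<^sub>M i\<in>I. borel) \<rightarrow>\<^sub>M prob_algebra borel"
    unfolding \<kappa>_def
  proof (rule measurable_distr_prob_space2[where M=borel])
    show "(\<lambda>_. \<nu>) \<in> (\<Pi>\<^sub>M i\<in>I. borel) \<rightarrow>\<^sub>M prob_algebra borel"
      using nu.prob_space_axioms by (intro measurable_const) (simp add: space_prob_algebra)
  qed measurable
  have disint: "emeasure M {\<omega> \<in> space M. (\<lambda>i\<in>I. W (r i) \<omega>) \<in> A \<and> W h \<omega> \<in> B} = (\<integral>\<^sup>+ z \<in> A. emeasure (\<kappa> z) B \<partial>\<mu>)"
    if [measurable]: "A \<in> sets (\<Pi>\<^sub>M i\<in>I. borel)" "B \<in> sets borel" for A B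
  proof -
    let ?E = "{u \<in> space (borel \<Otimes>\<^sub>M (\<Pi>\<^sub>M i\<in>I. borel)). snd u \<in> A \<and> fst u + (\<Sum>i\<in>I. c i * snd u i) \<in> B}"
    have E [measurable]: "?E \<in> sets (borel \<Otimes>\<^sub>M (\<Pi>\<^sub>M i\<in>I. borel))" by measurable
    have "emeasure M {\<omega> \<in> space M. (\<lambda>i\<in>I. W (r i) \<omega>) \<in> A \<and> W h \<omega> \<in> B}
      = emeasure M {\<omega> \<in> space M. (\<lambda>i\<in>I. W (r i) \<omega>) \<in> A \<and> W q \<omega> + (\<Sum>i\<in>I. c i * W (r i) \<omega>) \<in> B}"
      using Wh by (intro emeasure_eq_AE) auto
    also have "\<dots> = emeasure (distr M (borel \<Otimes>\<^sub>M (\<Pi>\<^sub>M i\<in>I. borel)) (\<lambda>\<omega>. (W q \<omega>, \<lambda>i\<in>I. W (r i) \<omega>))) ?E"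
      by (subst emeasure_distr[OF _ E], measurable)
        (auto simp: space_pair_measure space_PiM intro!: arg_cong[where f="emeasure M"])
    also have "\<dots> = emeasure (\<nu> \<Otimes>\<^sub>M \<mu>) ?E"
      unfolding \<nu>_def \<mu>_def by (simp only: W_orthogonal_independent[OF I r q qr])
    also have "\<dots> = (\<integral>\<^sup>+z. emeasure \<nu> ((\<lambda>y. (y, z)) -` ?E) \<partial>\<mu>)"
      by (rule P.emeasure_pair_measure_alt2) measurable
    also have "\<dots> = (\<integral>\<^sup>+ z \<in> A. emeasure (\<kappa> z) B \<partial>\<mu>)"
    proof (rule nn_integral_cong)
      fix z assume "z \<in> space \<mu>"
      then have z: "z \<in> space (\<Pi>\<^sub>M i\<in>I. borel)" by (simp add: \<mu>_def)
      have nu_space: "space \<nu> = UNIV" by (simp add: \<nu>_def)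
      have "emeasure (\<kappa> z) B = emeasure \<nu> ((\<lambda>y. y + (\<Sum>i\<in>I. c i * z i)) -` B)"
        unfolding \<kappa>_def by (subst emeasure_distr) (simp_all add: nu_space)
      moreover have "(\<lambda>y. (y, z)) -` ?E = (if z \<in> A then (\<lambda>y. y + (\<Sum>i\<in>I. c i * z i)) -` B else {})"
        using z by (auto simp: space_pair_measure)
      ultimately show "emeasure \<nu> ((\<lambda>y. (y, z)) -` ?E) = emeasure (\<kappa> z) B * indicator A z" by simp
    qed
    finally show ?thesis .
  qed
  have cont: "continuous_on T (\<lambda>z. \<integral>t. f t \<partial>\<kappa> z)" if f: "continuous_on UNIV f" "bounded (range f)" for f :: "real \<Rightarrow> real" and T
  proof -
    have [measurable]: "f \<in> borel_measurable borel" using f(1) by (rule borel_measurable_continuous_onI)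
    obtain C where C: "\<And>t. norm (f t) \<le> C" using f(2) by (auto simp: bounded_iff)
    have "isCont (\<lambda>s. \<integral>y. f (y + s) \<partial>\<nu>) s" for s
      unfolding continuous_at_sequentially comp_def
    proof safe
      fix u assume u: "u \<longlonglongrightarrow> s"
      show "(\<lambda>n. \<integral>y. f (y + u n) \<partial>\<nu>) \<longlonglongrightarrow> (\<integral>y. f (y + s) \<partial>\<nu>)"
      proof (rule integral_dominated_convergence[where w="\<lambda>_. C"])
        show "AE y in \<nu>. (\<lambda>n. f (y + u n)) \<longlonglongrightarrow> f (y + s)"
          using f(1) u by (intro AE_I2 continuous_on_tendsto_compose[OF f(1)] tendsto_intros) auto
      qed (use C in auto)
    qed
    then have "continuous_on UNIV (\<lambda>s. \<integral>y. f (y + s) \<partial>\<nu>)" by (simp add: continuous_at_imp_continuous_on)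
    moreover have "continuous_on T (\<lambda>z. \<Sum>i\<in>I. c i * z i)"
      by (intro continuous_intros continuous_on_product_then_coordinatewise[OF continuous_on_id])
    ultimately have "continuous_on T (\<lambda>z. \<integral>y. f (y + (\<Sum>i\<in>I. c i * z i)) \<partial>\<nu>)"
      by (rule continuous_on_compose2) auto
    then show ?thesis unfolding \<kappa>_def by (simp add: integral_distr)
  qed
  have nu_mean: "integrable \<nu> (\<lambda>y. y)" "(\<integral>y. y \<partial>\<nu>) = 0"
    using centred_gaussian_expectation[OF prob_space_axioms gaussian[OF q]]
    by (simp_all add: \<nu>_def integral_distr integrable_distr_eq)
  have mean: "integrable (\<kappa> z) (\<lambda>t. t) \<and> (\<integral>t. t \<partial>\<kappa> z) = (\<Sum>i\<in>I. c i * z i)" for z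
  proof -
    have "integrable \<nu> (\<lambda>y. y + b) \<and> (\<integral>y. y + b \<partial>\<nu>) = b" for b
      using nu_mean by (simp add: nu.prob_space)
    then show ?thesis unfolding \<kappa>_def by (simp add: integral_distr integrable_distr_eq)
  qed
  have "is_cond_distr M I (\<lambda>\<omega>. \<lambda>i\<in>I. W (r i) \<omega>) (W h) \<kappa>"
    unfolding is_cond_distr_def Let_def \<mu>_def[symmetric]
    by (intro conjI ballI allI impI kernel disint cont) simp_all
  with mean show ?thesis by blast
qed

end

section \<open>Partial derivatives and the \<open>C\<^sup>k\<close> norm\<close>

lemma partial_lin:
  assumes "f differentiable (at p)" "g differentiable (at p)"
  shows "partial b (\<lambda>x. \<alpha> * f x + \<beta> * g x) p = \<alpha> * partial b f p + \<beta> * partial b g p"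
proof -
  have line: "DERIV (\<lambda>t. h (p + t *\<^sub>R b)) 0 :> partial b h p" if "h differentiable (at p)" for h :: "'a \<Rightarrow> real"
  proof -
    have "(h \<circ> (\<lambda>t. p + t *\<^sub>R b)) differentiable (at (0::real))"
      using that by (intro differentiable_chain_at) (auto intro!: derivative_intros)
    then show ?thesis
      unfolding partial_def by (simp add: DERIV_deriv_iff_real_differentiable comp_def)
  qed
  show ?thesis
    unfolding partial_def[of b "\<lambda>x. \<alpha> * f x + \<beta> * g x"]
    by (intro DERIV_imp_deriv DERIV_add DERIV_cmult line assms)
qed

lemma partial_cong_open:
  assumes "open S" "p \<in> S" "\<And>x. x \<in> S \<Longrightarrow> f x = g x"
  shows "partial b f p = partial b g p"
proof -
  have "((\<lambda>t. p + t *\<^sub>R b) \<longlongrightarrow> p + 0 *\<^sub>R b) (nhds (0::real))"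
    by (intro tendsto_intros filterlim_ident)
  then have "\<forall>\<^sub>F t in nhds (0::real). p + t *\<^sub>R b \<in> S"
    using assms(1,2) by (auto dest: topological_tendstoD)
  then have "\<forall>\<^sub>F t in nhds (0::real). f (p + t *\<^sub>R b) = g (p + t *\<^sub>R b)"
    by eventually_elim (rule assms(3))
  then have "DERIV (\<lambda>t. f (p + t *\<^sub>R b)) 0 :> D \<longleftrightarrow> DERIV (\<lambda>t. g (p + t *\<^sub>R b)) 0 :> D" for D
    by (intro DERIV_cong_ev) auto
  then show ?thesis by (simp add: partial_def deriv_def)
qed

text \<open>The inner derivatives of both sides agree on \<open>S\<close> only, which suffices for the next derivative
  because \<open>S\<close> is open.\<close>

lemma iter_partial_lin:
  assumes S: "open S" and f: "Ck_on m S f" and g: "Ck_on m S g" and "bs \<in> multi_dirs m" "p \<in> S"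
  shows "iter_partial bs (\<lambda>x. \<alpha> * f x + \<beta> * g x) p = \<alpha> * iter_partial bs f p + \<beta> * iter_partial bs g p"
  using assms(4,5)
proof (induction bs arbitrary: p)
  case (Cons b bs)
  then have bs: "bs \<in> multi_dirs m" "length bs < m" by (auto simp: multi_dirs_def)
  then have "iter_partial bs f differentiable (at p)" "iter_partial bs g differentiable (at p)"
    using f g Cons.prems by (auto simp: Ck_on_def)
  moreover have "partial b (iter_partial bs (\<lambda>x. \<alpha> * f x + \<beta> * g x)) p
    = partial b (\<lambda>x. \<alpha> * iter_partial bs f x + \<beta> * iter_partial bs g x) p"
    by (rule partial_cong_open[OF S]) (use Cons bs in auto)
  ultimately show ?case by (simp add: partial_lin)
qed simp

lemma finite_multi_dirs: "finite (multi_dirs m :: 'a::euclidean_space list set)"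
  unfolding multi_dirs_def by (rule finite_lists_length_le) (rule finite_Basis)

lemma iter_partial_le_Ck_norm:
  assumes "bounded S" "Ck_closure m S f" "bs \<in> multi_dirs m" "p \<in> S"
  shows "\<bar>iter_partial bs f p\<bar> \<le> Ck_norm m S f"
proof -
  obtain g where g: "continuous_on (closure S) g" "\<And>p. p \<in> S \<Longrightarrow> g p = iter_partial bs f p"
    using assms(2,3) unfolding Ck_closure_def by blast
  have "bounded (g ` closure S)"
    using g(1) assms(1) by (intro compact_imp_bounded compact_continuous_image) auto
  then obtain B where B: "\<And>p. p \<in> closure S \<Longrightarrow> \<bar>g p\<bar> \<le> B" by (auto simp: bounded_iff)
  have "bdd_above ((\<lambda>p. \<bar>iter_partial bs f p\<bar>) ` S)"
    using B g(2) closure_subset[of S] by (auto intro!: bdd_aboveI2[of _ _ B] simp flip: g(2))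
  then have "\<bar>iter_partial bs f p\<bar> \<le> (SUP p\<in>S. \<bar>iter_partial bs f p\<bar>)"
    using assms(4) by (intro cSUP_upper)
  also have "\<dots> \<le> Ck_norm m S f"
    unfolding Ck_norm_def using assms(3) finite_multi_dirs by (intro Max_ge) auto
  finally show ?thesis .
qed

lemma Ck_norm_nonneg:
  assumes "bounded S" "Ck_closure m S f" "S \<noteq> {}"
  shows "0 \<le> Ck_norm m S f"
proof -
  obtain p where "p \<in> S" using assms by auto
  then have "\<bar>iter_partial [] f p\<bar> \<le> Ck_norm m S f"
    using assms by (intro iter_partial_le_Ck_norm) (auto simp: multi_dirs_def)
  then show ?thesis by simp
qed

section \<open>The conditions as bounded linear functionals\<close>

lemma iter_partial_in_dual_space:
  assumes S: "open S" "bounded S" and emb: "continuously_embedded_Ck m S U ip"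
    and "bs \<in> multi_dirs m" "p \<in> S"
  shows "(\<lambda>f. iter_partial bs f p) \<in> dual_space U ip"
proof -
  obtain C where C: "\<And>f. f \<in> U \<Longrightarrow> Ck_norm m S f \<le> C * ip_norm ip f" and U: "\<And>f. f \<in> U \<Longrightarrow> Ck_closure m S f"
    using emb unfolding continuously_embedded_Ck_def by blast
  have "\<bar>iter_partial bs f p\<bar> \<le> C * ip_norm ip f" if "f \<in> U" for f
    using iter_partial_le_Ck_norm[OF S(2) U[OF that] assms(4,5)] C[OF that] by linarith
  moreover have "iter_partial bs (\<lambda>x. a * f x + b * g x) p = a * iter_partial bs f p + b * iter_partial bs g p"
    if "f \<in> U" "g \<in> U" for f g a b
    using U that assms by (intro iter_partial_lin[OF S(1)]) (auto simp: Ck_closure_def)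
  ultimately show ?thesis by (intro dual_spaceI)
qed

lemma dirx_Basis: "dirx k \<in> Basis" and dirv_Basis: "dirv k \<in> Basis"
  by (auto simp: dirx_def dirv_def Basis_prod_def axis_in_Basis_iff)

lemma phase_multi_dirs:
  "[] \<in> multi_dirs 2" "[dirx k] \<in> multi_dirs 2" "[dirv k] \<in> multi_dirs 2"
  "[dirv k, dirv i] \<in> multi_dirs 2" "[dirx i, dirv k] \<in> multi_dirs 2"
  by (auto simp: multi_dirs_def dirx_Basis dirv_Basis)

lemma cond_functional_in_dual_space:
  fixes \<Omega> :: "('d::finite) phase set"
  assumes \<Omega>: "open \<Omega>" "bounded \<Omega>" and emb: "continuously_embedded_Ck 2 \<Omega> U ip"
    and pts: "\<And>j. (x j, v j) \<in> \<Omega>" "xb \<in> \<Omega>"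
  shows "cond_functional x v a xb c \<in> dual_space U ip"
proof -
  note jet = iter_partial_in_dual_space[OF \<Omega> emb]
  show ?thesis
  proof (cases c)
    case (Obs j k)
    let ?p = "(x j, v j)"
    have "cond_functional x v a xb (Obs j k) = (\<lambda>L. (\<Sum>i\<in>UNIV. a j $ i * iter_partial [dirv k, dirv i] L ?p)
      + (\<Sum>i\<in>UNIV. v j $ i * iter_partial [dirx i, dirv k] L ?p) + (- 1) * iter_partial [dirx k] L ?p)"
      by (auto simp: EL_def mult.commute)
    also have "\<dots> \<in> dual_space U ip"
      by (intro dual_space_add dual_space_sum dual_space_scale jet pts phase_multi_dirs finite)
    finally show ?thesis using Obs by simp
  next
    case (Momentum k)
    have "cond_functional x v a xb (Momentum k) = (\<lambda>L. iter_partial [dirv k] L xb)"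
      by (auto simp: PhiN_def)
    then show ?thesis using Momentum jet[OF phase_multi_dirs(3) pts(2)] by simp
  next
    case Val
    have "cond_functional x v a xb Val = (\<lambda>L. iter_partial [] L xb)" by (auto simp: PhiN_def)
    then show ?thesis using Val jet[OF phase_multi_dirs(1) pts(2)] by simp
  qed
qed

section \<open>Consistency with the dynamics from a dense set of observations\<close>

lemma continuous_on_det:
  fixes A :: "'p::topological_space \<Rightarrow> real^'n^'n"
  assumes "\<And>i j. continuous_on T (\<lambda>p. A p $ i $ j)"
  shows "continuous_on T (\<lambda>p. det (A p))"
  unfolding det_def by (intro continuous_intros assms)

text \<open>The terms of the Euler--Lagrange equation free of the acceleration, with opposite sign: the
  equation reads Hessian times acceleration equals force.\<close>

definition EL_force :: "('d::finite phase \<Rightarrow> real) \<Rightarrow> 'd phase \<Rightarrow> real^'d" where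
  "EL_force L p = (\<chi> k. partial (dirx k) L p - (\<Sum>i\<in>UNIV. partial (dirx i) (partial (dirv k) L) p * snd p $ i))"

lemma EL_eq_hessian_force: "EL L x v a = vel_hessian L (x, v) *v a - EL_force L (x, v)"
  by (simp add: EL_def EL_force_def vel_hessian_def matrix_vector_mult_def vec_eq_iff)

lemma continuous_on_EL_coefficients:
  assumes "Ck_on 2 \<Omega> L"
  shows "continuous_on \<Omega> (\<lambda>p. vel_hessian L p $ k $ i)" "continuous_on \<Omega> (\<lambda>p. EL_force L p $ k)"
proof -
  have jet: "continuous_on \<Omega> (iter_partial bs L)" if "bs \<in> multi_dirs 2" for bs
    using assms that by (auto simp: Ck_on_def)
  show "continuous_on \<Omega> (\<lambda>p. vel_hessian L p $ k $ i)"
    using jet[OF phase_multi_dirs(4)[of k i]] by (simp add: vel_hessian_def)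
  have "continuous_on \<Omega> (partial (dirx k) L)" "continuous_on \<Omega> (partial (dirx i) (partial (dirv k) L))" for i
    using jet[OF phase_multi_dirs(2)[of k]] jet[OF phase_multi_dirs(5)[of i k]] by simp_all
  then show "continuous_on \<Omega> (\<lambda>p. EL_force L p $ k)"
    by (simp add: EL_force_def) (intro continuous_intros)
qed

text \<open>Since the velocity Hessian of \<open>Lref\<close> is invertible, \<open>EL Lref = 0\<close> determines the acceleration as a
  continuous function of the position and velocity, and inserting it into \<open>EL L\<close> gives a continuous
  function that vanishes on a dense set. Cramer's rule keeps this polynomial: \<open>N i\<close> and \<open>D\<close> are the
  numerator and denominator of the \<open>i\<close>-th acceleration, and \<open>G k\<close> is the \<open>k\<close>-th component of \<open>EL L\<close>
  multiplied by \<open>D\<close>, so that continuity needs no division.\<close>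

lemma dynamics_consistent_if_dense:
  fixes \<Omega> :: "('d::finite) phase set"
  assumes ref: "Ck_on 2 \<Omega> Lref" "nondegenerate \<Omega> Lref" and L: "Ck_on 2 \<Omega> L"
    and pts: "\<And>j. (x j, v j) \<in> \<Omega>" and dense: "\<Omega> \<subseteq> closure (range (\<lambda>j. (x j, v j)))"
    and ref0: "\<And>j. EL Lref (x j) (v j) (a j) = 0" and L0: "\<And>j. EL L (x j) (v j) (a j) = 0"
  shows "dynamics_consistent \<Omega> Lref L"
proof -
  define N where "N = (\<lambda>k p. det (\<chi> i j. if j = k then EL_force Lref p $ i else vel_hessian Lref p $ i $ j))"
  define D where "D = (\<lambda>p. det (vel_hessian Lref p))"
  define G where "G = (\<lambda>k p. (\<Sum>i\<in>UNIV. vel_hessian L p $ k $ i * N i p) - EL_force L p $ k * D p)"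
  have G_eq: "G k (x', v') = D (x', v') * EL L x' v' a' $ k" if "EL Lref x' v' a' = 0" for k x' v' a'
  proof -
    have "vel_hessian Lref (x', v') *v a' = EL_force Lref (x', v')"
      using that by (simp add: EL_eq_hessian_force)
    then have "N i (x', v') = a' $ i * D (x', v')" for i
      using cramer_lemma[of i "vel_hessian Lref (x', v')" a'] by (simp only: N_def D_def)
    then show ?thesis
      by (simp add: G_def EL_eq_hessian_force matrix_vector_mult_def sum_distrib_left algebra_simps)
  qed
  have cont: "continuous_on \<Omega> (G k)" for k
  proof -
    have "continuous_on \<Omega> (N i)" for i
      unfolding N_def
    proof (rule continuous_on_det)
      fix k j
      show "continuous_on \<Omega> (\<lambda>p. (\<chi> k j. if j = i then EL_force Lref p $ k else vel_hessian Lref p $ k $ j) $ k $ j)"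
        using continuous_on_EL_coefficients[OF ref(1)] by (cases "j = i") simp_all
    qed
    moreover have "continuous_on \<Omega> D"
      unfolding D_def using continuous_on_EL_coefficients[OF ref(1)] by (intro continuous_on_det) auto
    ultimately show ?thesis
      unfolding G_def using continuous_on_EL_coefficients[OF L]
      by (intro continuous_on_diff continuous_on_sum continuous_on_mult)
  qed
  have G0: "G k p = 0" if p: "p \<in> \<Omega>" for k p
  proof -
    obtain s where s: "\<And>n. s n \<in> range (\<lambda>j. (x j, v j))" "s \<longlonglongrightarrow> p"
      using subsetD[OF dense p] unfolding closure_sequential by blast
    have "G k (s n) = 0" and "s n \<in> \<Omega>" for n using s(1)[of n] pts G_eq[OF ref0] L0 by auto
    then have "(\<lambda>n. 0) \<longlonglongrightarrow> G k p"
      using continuous_on_tendsto_compose[OF cont s(2) p, of k] by simp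
    then show ?thesis by (simp add: LIMSEQ_const_iff)
  qed
  show ?thesis
    unfolding dynamics_consistent_def
  proof (intro allI impI, elim conjE)
    fix x' v' a' assume p: "(x', v') \<in> \<Omega>" and e: "EL Lref x' v' a' = 0"
    have "invertible (vel_hessian Lref (x', v'))"
      using ref(2) p closure_subset[of \<Omega>] unfolding nondegenerate_def by (metis subsetD)
    then have "D (x', v') \<noteq> 0" by (simp add: D_def invertible_det_nz)
    then show "EL L x' v' a' = 0"
      using G_eq[OF e] G0[OF p] by (simp add: vec_eq_iff)
  qed
qed

section \<open>Minimal norm interpolation\<close>

context hilbert_functions
begin

text \<open>Each \<open>L j\<close> lies in the span of the representers of its conditions, so \<open>f - L j\<close> is orthogonal to
  \<open>L j\<close> for every \<open>f\<close> that satisfies these conditions. Applied to \<open>f = L m\<close> with \<open>m \<ge> j\<close> this gives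
  \<open>\<parallel>L m - L j\<parallel>\<^sup>2 = \<parallel>L m\<parallel>\<^sup>2 - \<parallel>L j\<parallel>\<^sup>2\<close>; applied to \<open>G\<close> it bounds the norms. Hence the squared norms
  increase to a limit and the sequence is Cauchy. Orthogonality survives the limit and becomes the
  Pythagorean identity in the conclusion, from which minimality and uniqueness will be read off.\<close>

lemma nested_interpolation_converges:
  fixes r :: "'i \<Rightarrow> 'a \<Rightarrow> real" and I :: "nat \<Rightarrow> 'i set" and c :: "nat \<Rightarrow> 'i \<Rightarrow> real"
  assumes r: "\<And>i. r i \<in> U" and G: "G \<in> U" and mono: "mono I"
    and L_def: "\<And>j. L j = (\<lambda>x. \<Sum>i\<in>I j. c j i * r i x)"
    and interp: "\<And>j k. k \<in> I j \<Longrightarrow> ip (L j) (r k) = ip G (r k)"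
  shows "\<exists>Linf\<in>U. (\<lambda>j. ip_norm ip (\<lambda>x. L j x - Linf x)) \<longlonglongrightarrow> 0 \<and>
    (\<forall>j. \<forall>k\<in>I j. ip Linf (r k) = ip G (r k)) \<and>
    (\<forall>f\<in>U. (\<forall>j. \<forall>k\<in>I j. ip f (r k) = ip G (r k)) \<longrightarrow>
      ip f f = ip Linf Linf + ip (\<lambda>x. f x - Linf x) (\<lambda>x. f x - Linf x))"
proof -
  have L: "L j \<in> U" for j unfolding L_def by (intro sum_mem r)
  have orth: "ip f (L j) = ip (L j) (L j)" if "f \<in> U" "\<And>k. k \<in> I j \<Longrightarrow> ip f (r k) = ip G (r k)" for f j
  proof -
    have "ip f' (L j) = (\<Sum>i\<in>I j. c j i * ip f' (r i))" if "f' \<in> U" for f'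
      using ip_sym[OF that L] ip_sym[OF that r] unfolding L_def by (simp add: ip_sum[OF r that])
    then show ?thesis using that interp L by simp
  qed
  have mixed: "ip (L m) (L n) = ip (L n) (L n)" if "n \<le> m" for m n
    using L interp monoD[OF mono that] by (intro orth) auto
  define q where "q = (\<lambda>n. ip (L n) (L n))"
  have dist: "ip (\<lambda>x. L m x - L n x) (\<lambda>x. L m x - L n x) = q m - q n" if "n \<le> m" for m n
    using ip_diff_self[OF L L, of m n] mixed[OF that] by (simp add: q_def)
  have "incseq q"
    unfolding incseq_def using dist ip_nonneg[OF diff_mem[OF L L]] by (metis diff_ge_0_iff_ge)
  moreover have "q n \<le> ip G G" for n
    using ip_nonneg[OF diff_mem[OF G L[of n]]] ip_diff_self[OF G L, of n] orth[OF G, of n] by (simp add: q_def)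
  ultimately obtain l where "q \<longlonglongrightarrow> l" using incseq_convergent[of q "ip G G"] by blast
  then have Cauchy: "Cauchy q" by (rule LIMSEQ_imp_Cauchy)
  have "\<exists>f\<in>U. (\<lambda>n. ip_norm ip (\<lambda>x. L n x - f x)) \<longlonglongrightarrow> 0"
  proof (rule complete[OF L])
    fix e :: real assume "e > 0"
    then obtain N where N: "\<And>m n. m \<ge> N \<Longrightarrow> n \<ge> N \<Longrightarrow> \<bar>q m - q n\<bar> < e\<^sup>2"
      using Cauchy zero_less_power[of e 2] unfolding Cauchy_def dist_real_def by blast
    have "ip_norm ip (\<lambda>x. L m x - L n x) < e" if mn: "m \<ge> N" "n \<ge> N" for m n
    proof -
      have "ip (\<lambda>x. L m x - L n x) (\<lambda>x. L m x - L n x) = \<bar>q m - q n\<bar>"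
      proof (cases "n \<le> m")
        case True
        then show ?thesis using dist[OF True] ip_nonneg[OF diff_mem[OF L L], of m n] by simp
      next
        case False
        then have "n \<ge> m" by simp
        from dist[OF this] show ?thesis
          using ip_nonneg[OF diff_mem[OF L L], of n m] ip_diff_self[OF L L] ip_sym[OF L L] by simp
      qed
      then show ?thesis
        using N[OF mn] \<open>e > 0\<close> unfolding ip_norm_def by (simp add: real_less_lsqrt)
    qed
    then show "\<exists>N. \<forall>m\<ge>N. \<forall>n\<ge>N. ip_norm ip (\<lambda>x. L m x - L n x) < e" by blast
  qed
  then obtain Linf where Linf: "Linf \<in> U" "(\<lambda>n. ip_norm ip (\<lambda>x. L n x - Linf x)) \<longlonglongrightarrow> 0" by blast
  note lim = ip_tendsto[OF L Linf(1) _ Linf(2)]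
  have val: "ip Linf (r k) = ip G (r k)" if "k \<in> I j" for j k
  proof (rule LIMSEQ_unique[OF lim[OF r]])
    have "\<forall>\<^sub>F n in sequentially. ip (L n) (r k) = ip G (r k)"
      using that monoD[OF mono] interp by (intro eventually_sequentiallyI[of j]) blast
    then show "(\<lambda>n. ip (L n) (r k)) \<longlonglongrightarrow> ip G (r k)" by (rule tendsto_eventually)
  qed
  have pyth: "ip f f = ip Linf Linf + ip (\<lambda>x. f x - Linf x) (\<lambda>x. f x - Linf x)"
    if f: "f \<in> U" "\<And>j k. k \<in> I j \<Longrightarrow> ip f (r k) = ip G (r k)" for f
  proof -
    have d: "(\<lambda>x. f x - Linf x) \<in> U" using f(1) Linf(1) by (rule diff_mem)
    have "ip (L n) (\<lambda>x. f x - Linf x) = 0" for n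
    proof -
      have "ip (\<lambda>x. f x - Linf x) (L n) = 0"
        using orth[OF f(1), of n] orth[OF Linf(1), of n] f(2) val by (simp add: ip_diff[OF f(1) Linf(1) L])
      then show ?thesis using ip_sym[OF L d] by simp
    qed
    then have "ip Linf (\<lambda>x. f x - Linf x) = 0" using lim[OF d] by (simp add: LIMSEQ_const_iff)
    then have "ip f Linf = ip Linf Linf"
      using ip_sym[OF Linf(1) d] ip_diff[OF f(1) Linf(1) Linf(1)] by simp
    then show ?thesis using ip_diff_self[OF f(1) Linf(1)] by simp
  qed
  show ?thesis using Linf val pyth by blast
qed

end

section \<open>Conditional means of the canonical Gaussian field\<close>

text \<open>The field is linear only almost surely, so the conditional distribution found for the values of \<open>W\<close>
  has to be carried over to the given random variables.\<close>

lemma is_cond_distr_cong_AE: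
  assumes "Z \<in> M \<rightarrow>\<^sub>M (\<Pi>\<^sub>M i\<in>I. borel)" "Z' \<in> M \<rightarrow>\<^sub>M (\<Pi>\<^sub>M i\<in>I. borel)"
    and "X \<in> borel_measurable M" "X' \<in> borel_measurable M"
    and Z: "AE \<omega> in M. Z \<omega> = Z' \<omega>" and X: "AE \<omega> in M. X \<omega> = X' \<omega>"
    and k: "is_cond_distr M I Z X \<kappa>"
  shows "is_cond_distr M I Z' X' \<kappa>"
proof -
  have [measurable]: "Z \<in> M \<rightarrow>\<^sub>M (\<Pi>\<^sub>M i\<in>I. borel)" "Z' \<in> M \<rightarrow>\<^sub>M (\<Pi>\<^sub>M i\<in>I. borel)"
    "X \<in> borel_measurable M" "X' \<in> borel_measurable M" by fact+
  have "distr M (\<Pi>\<^sub>M i\<in>I. borel) Z = distr M (\<Pi>\<^sub>M i\<in>I. borel) Z'"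
    using Z by (intro distr_cong_AE) auto
  moreover have "emeasure M {\<omega> \<in> space M. Z \<omega> \<in> A \<and> X \<omega> \<in> B} = emeasure M {\<omega> \<in> space M. Z' \<omega> \<in> A \<and> X' \<omega> \<in> B}"
    if [measurable]: "A \<in> sets (\<Pi>\<^sub>M i\<in>I. borel)" "B \<in> sets borel" for A B
    using Z X by (intro emeasure_eq_AE) auto
  ultimately show ?thesis using k unfolding is_cond_distr_def Let_def by simp
qed

lemma canonical_field_linear:
  assumes "canonical_gaussian_field M S K U ip \<xi>"
    and "\<phi> \<in> dual_space U ip" "\<psi> \<in> dual_space U ip" "\<eta> \<in> dual_space U ip"
    and "\<And>f. f \<in> U \<Longrightarrow> \<eta> f = a * \<phi> f + b * \<psi> f"
  shows "AE \<omega> in M. \<xi> \<eta> \<omega> = a * \<xi> \<phi> \<omega> + b * \<xi> \<psi> \<omega>"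
  using assms unfolding canonical_gaussian_field_def by blast

lemma canonical_field_isonormal:
  assumes rkhs: "is_rkhs S K U ip" and field: "canonical_gaussian_field M S K U ip \<xi>"
  shows "isonormal_process S U ip M (\<lambda>r. \<xi> (\<lambda>f. ip f r))"
proof -
  interpret hilbert_functions S U ip using rkhs by unfold_locales (simp add: is_rkhs_def)
  interpret prob_space M using field by (simp add: canonical_gaussian_field_def)
  have cov: "cov_operator S K (\<lambda>f. ip f r) = r" if r: "r \<in> U" for r
  proof
    fix x
    have "ip (kernel_section S K x) r = r x" if "x \<in> S"
      using rkhs ip_sym[OF r] that r unfolding is_rkhs_def by metis
    then show "cov_operator S K (\<lambda>f. ip f r) x = r x"
      using zero_off[OF r] by (simp add: cov_operator_def)
  qed
  show ?thesis
  proof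
    fix r assume r: "r \<in> U"
    have "centred_gaussian M (\<xi> (\<lambda>f. ip f r)) (ip (cov_operator S K (\<lambda>f. ip f r)) r)"
      using field ip_in_dual_space[OF r] unfolding canonical_gaussian_field_def by blast
    then show "centred_gaussian M (\<xi> (\<lambda>f. ip f r)) (ip r r)" by (simp add: cov[OF r])
  next
    fix r s a b assume r: "r \<in> U" and s: "s \<in> U"
    have "ip f (\<lambda>x. a * r x + b * s x) = a * ip f r + b * ip f s" if "f \<in> U" for f
      using ip_lin[OF r s that] ip_sym[OF that] r s lin_mem by simp
    then show "AE \<omega> in M. \<xi> (\<lambda>f. ip f (\<lambda>x. a * r x + b * s x)) \<omega> = a * \<xi> (\<lambda>f. ip f r) \<omega> + b * \<xi> (\<lambda>f. ip f s) \<omega>"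
      by (rule canonical_field_linear[OF field ip_in_dual_space[OF r] ip_in_dual_space[OF s] ip_in_dual_space[OF lin_mem[OF r s]]])
  qed
qed

text \<open>Conditioning a Gaussian field is interpolation: the conditional mean is the element of the span of
  the representers that takes the prescribed values. For a functional with representer \<open>h\<close>, the
  conditional mean is \<open>\<Sum> d\<^sub>i y\<^sub>i\<close>, where \<open>\<Sum> d\<^sub>i r\<^sub>i\<close> is the projection of \<open>h\<close>; as \<open>L\<close> lies in the span, this
  equals \<open>\<langle>h, L\<rangle>\<close>. No other element qualifies, since the conditional distribution at \<open>y\<close> is unique and
  the functionals separate the points of \<open>U\<close>.\<close>

proposition cond_mean_eq_interpolant:
  fixes \<Phi> :: "'i \<Rightarrow> ('a \<Rightarrow> real) \<Rightarrow> real"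
  assumes rkhs: "is_rkhs S K U ip" and field: "canonical_gaussian_field M S K U ip \<xi>"
    and I: "finite I" and \<Phi>: "\<And>i. i \<in> I \<Longrightarrow> \<Phi> i \<in> dual_space U ip"
    and r: "\<And>i. i \<in> I \<Longrightarrow> r i \<in> U" "\<And>i f. i \<in> I \<Longrightarrow> f \<in> U \<Longrightarrow> \<Phi> i f = ip f (r i)"
    and L: "L = (\<lambda>x. \<Sum>i\<in>I. c i * r i x)" and y: "\<And>i. i \<in> I \<Longrightarrow> \<Phi> i L = y i"
  shows "cond_mean M U ip \<xi> I \<Phi> y = L"
proof -
  define W where "W = (\<lambda>r. \<xi> (\<lambda>f. ip f r))"
  interpret isonormal_process S U ip M W
    unfolding W_def using rkhs field by (rule canonical_field_isonormal)
  have meas: "\<xi> \<phi> \<in> borel_measurable M" if "\<phi> \<in> dual_space U ip" for \<phi>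
    using field that by (auto simp: canonical_gaussian_field_def centred_gaussian_def)
  have \<xi>_eq_W: "AE \<omega> in M. \<xi> \<phi> \<omega> = W h \<omega>"
    if "\<phi> \<in> dual_space U ip" "h \<in> U" "\<And>f. f \<in> U \<Longrightarrow> \<phi> f = ip f h" for \<phi> h
  proof -
    have "AE \<omega> in M. \<xi> \<phi> \<omega> = 1 * W h \<omega> + 0 * W h \<omega>"
      unfolding W_def
      by (rule canonical_field_linear[OF field ip_in_dual_space[OF that(2)] ip_in_dual_space[OF that(2)] that(1)]) (simp add: that(3))
    then show ?thesis by simp
  qed
  have LU: "L \<in> U" unfolding L by (intro sum_mem r)
  define Z where "Z = (\<lambda>\<omega>. \<lambda>i\<in>I. \<xi> (\<Phi> i) \<omega>)"
  define Z' where "Z' = (\<lambda>\<omega>. \<lambda>i\<in>I. W (r i) \<omega>)"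
  have Z [measurable]: "Z \<in> M \<rightarrow>\<^sub>M (\<Pi>\<^sub>M i\<in>I. borel)" unfolding Z_def by (intro measurable_restrict meas \<Phi>)
  have Z' [measurable]: "Z' \<in> M \<rightarrow>\<^sub>M (\<Pi>\<^sub>M i\<in>I. borel)" unfolding Z'_def by (intro measurable_restrict W_measurable r)
  have "AE \<omega> in M. \<forall>i\<in>I. \<xi> (\<Phi> i) \<omega> = W (r i) \<omega>"
    using I by (intro AE_ball_countable' \<xi>_eq_W \<Phi> r countable_finite)
  then have ZZ': "AE \<omega> in M. Z' \<omega> = Z \<omega>"
    by eventually_elim (auto simp: Z_def Z'_def)
  have support: "restrict y I \<in> measure_support I (distr M (\<Pi>\<^sub>M i\<in>I. borel) Z)"
  proof -
    have "0 < emeasure (distr M (\<Pi>\<^sub>M i\<in>I. borel) Z')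
      {w \<in> space (\<Pi>\<^sub>M i\<in>I. borel). \<forall>i\<in>I. \<bar>w i - restrict y I i\<bar> < e}" if e: "0 < e" for e
    proof -
      have B [measurable]: "{w \<in> space (\<Pi>\<^sub>M i\<in>I. borel). \<forall>i\<in>I. \<bar>w i - restrict y I i\<bar> < e} \<in> sets (\<Pi>\<^sub>M i\<in>I. borel)"
        using I by measurable
      have "0 < emeasure M {\<omega> \<in> space M. \<forall>i\<in>I. \<bar>W (r i) \<omega> - ip L (r i)\<bar> < e}"
        using I r(1) LU e by (rule W_near_pos)
      also have "{\<omega> \<in> space M. \<forall>i\<in>I. \<bar>W (r i) \<omega> - ip L (r i)\<bar> < e}
        = Z' -` {w \<in> space (\<Pi>\<^sub>M i\<in>I. borel). \<forall>i\<in>I. \<bar>w i - restrict y I i\<bar> < e} \<inter> space M"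
        using r(2)[OF _ LU] y by (auto simp: Z'_def space_PiM)
      finally show ?thesis by (simp only: emeasure_distr[OF Z' B])
    qed
    moreover have "distr M (\<Pi>\<^sub>M i\<in>I. borel) Z' = distr M (\<Pi>\<^sub>M i\<in>I. borel) Z"
      using ZZ' by (intro distr_cong_AE) auto
    ultimately show ?thesis by (auto simp: measure_support_def space_PiM)
  qed
  have kernel: "\<exists>\<kappa>. is_cond_distr M I Z (\<xi> \<phi>) \<kappa> \<and> integrable (\<kappa> (restrict y I)) (\<lambda>t. t) \<and>
      (\<integral>t. t \<partial>\<kappa> (restrict y I)) = \<phi> L" if \<phi>: "\<phi> \<in> dual_space U ip" for \<phi>
  proof -
    obtain h where h: "h \<in> U" "\<And>f. f \<in> U \<Longrightarrow> \<phi> f = ip f h" using riesz[OF \<phi>] by blast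
    have "\<exists>d. \<forall>k\<in>I. ip (\<lambda>x. h x - (\<Sum>i\<in>I. d i * r i x)) (r k) = 0"
      using I r(1) h(1) by (rule ex_projection_coeffs)
    then obtain d where d: "\<And>k. k \<in> I \<Longrightarrow> ip (\<lambda>x. h x - (\<Sum>i\<in>I. d i * r i x)) (r k) = 0" by blast
    have "\<exists>\<kappa>. is_cond_distr M I (\<lambda>\<omega>. \<lambda>i\<in>I. W (r i) \<omega>) (W h) \<kappa> \<and>
        (\<forall>z. integrable (\<kappa> z) (\<lambda>t. t) \<and> (\<integral>t. t \<partial>\<kappa> z) = (\<Sum>i\<in>I. d i * z i))"
      using I r(1) h(1) d by (rule W_cond_distr)
    then obtain \<kappa> where \<kappa>: "is_cond_distr M I Z' (W h) \<kappa>" "\<And>z. integrable (\<kappa> z) (\<lambda>t. t)"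
      "\<And>z. (\<integral>t. t \<partial>\<kappa> z) = (\<Sum>i\<in>I. d i * z i)"
      unfolding Z'_def by blast
    have "AE \<omega> in M. \<xi> \<phi> \<omega> = W h \<omega>" using \<phi> h by (rule \<xi>_eq_W)
    then have AE: "AE \<omega> in M. W h \<omega> = \<xi> \<phi> \<omega>" by eventually_elim simp
    have "is_cond_distr M I Z (\<xi> \<phi>) \<kappa>"
      by (rule is_cond_distr_cong_AE[OF Z' Z W_measurable[OF h(1)] meas[OF \<phi>] ZZ' AE \<kappa>(1)])
    moreover have "(\<Sum>i\<in>I. d i * restrict y I i) = \<phi> L"
    proof -
      let ?p = "\<lambda>x. \<Sum>i\<in>I. d i * r i x"
      have p: "?p \<in> U" by (intro sum_mem r)
      have hp: "(\<lambda>x. h x - ?p x) \<in> U" using h(1) p by (rule diff_mem)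
      have "ip L (\<lambda>x. h x - ?p x) = (\<Sum>k\<in>I. c k * ip (r k) (\<lambda>x. h x - ?p x))"
        unfolding L by (rule ip_sum[OF r(1) hp])
      also have "\<dots> = 0" using d ip_sym[OF r(1) hp] by simp
      finally have "ip h L = ip ?p L" using ip_sym[OF LU hp] ip_diff[OF h(1) p LU] by simp
      also have "\<dots> = (\<Sum>i\<in>I. d i * ip (r i) L)" by (rule ip_sum[OF r(1) LU])
      also have "\<dots> = (\<Sum>i\<in>I. d i * restrict y I i)"
        using r(2)[OF _ LU] y ip_sym[OF r(1) LU] by simp
      finally show ?thesis using h LU ip_sym by simp
    qed
    ultimately show ?thesis using \<kappa> by metis
  qed
  have is_mean: "is_cond_mean M U ip \<xi> I \<Phi> y L"
    unfolding is_cond_mean_def Let_def Z_def[symmetric] using LU support kernel by blast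
  show ?thesis
    unfolding cond_mean_def
  proof (rule the_equality)
    show "is_cond_mean M U ip \<xi> I \<Phi> y L" by (rule is_mean)
  next
    fix L' assume L': "is_cond_mean M U ip \<xi> I \<Phi> y L'"
    then have L'U: "L' \<in> U" by (simp add: is_cond_mean_def Let_def)
    define D where "D = (\<lambda>x. L' x - L x)"
    have D: "D \<in> U" unfolding D_def using L'U LU by (rule diff_mem)
    obtain \<kappa> where \<kappa>: "is_cond_distr M I Z (\<xi> (\<lambda>f. ip f D)) \<kappa>" "(\<integral>t. t \<partial>\<kappa> (restrict y I)) = ip L D"
      using kernel[OF ip_in_dual_space[OF D]] by blast
    obtain \<kappa>' where \<kappa>': "is_cond_distr M I Z (\<xi> (\<lambda>f. ip f D)) \<kappa>'" "(\<integral>t. t \<partial>\<kappa>' (restrict y I)) = ip L' D"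
      using L' ip_in_dual_space[OF D] unfolding is_cond_mean_def Let_def Z_def[symmetric] by blast
    have "\<kappa> (restrict y I) = \<kappa>' (restrict y I)"
      by (rule cond_distr_unique_on_support[OF prob_space_axioms I Z \<kappa>(1) \<kappa>'(1) support])
    then have "ip D D = 0" using \<kappa> \<kappa>' ip_diff[OF L'U LU D] by (simp add: D_def)
    then have "D = (\<lambda>x. 0)" by (rule ip_eq_0[OF D])
    then show "L' = L" by (simp add: D_def fun_eq_iff)
  qed
qed

section \<open>Convergence of the conditional means\<close>

lemma finite_cond_indices: "finite (cond_indices j :: 'd::finite cond_index set)"
proof -
  have "{Obs i k | i k. i < j} = (\<lambda>(i, k :: 'd). Obs i k) ` ({..<j} \<times> UNIV)" by auto
  then show ?thesis by (simp add: cond_indices_def)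
qed

lemma mono_cond_indices: "mono (cond_indices :: nat \<Rightarrow> 'd::finite cond_index set)"
  by (rule monoI) (auto simp: cond_indices_def)

lemma conditions_iff:
  "(\<forall>j. \<forall>c\<in>cond_indices j. cond_functional x v a xb c L = cond_value pb cb c)
    \<longleftrightarrow> PhiN xb L = (pb, cb) \<and> (\<forall>j. EL L (x j) (v j) (a j) = 0)"
proof safe
  assume *: "\<forall>j. \<forall>c\<in>cond_indices j. cond_functional x v a xb c L = cond_value pb cb c"
  have "cond_functional x v a xb (Momentum k) L = pb $ k" for k
    using *[rule_format, of "Momentum k" 0] by (simp add: cond_indices_def)
  moreover have "cond_functional x v a xb Val L = cb"
    using *[rule_format, of Val 0] by (simp add: cond_indices_def)
  ultimately show "PhiN xb L = (pb, cb)" by (simp add: prod_eq_iff vec_eq_iff)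
  fix j
  have "cond_functional x v a xb (Obs j k) L = 0" for k
    using *[rule_format, of "Obs j k" "Suc j"] by (simp add: cond_indices_def)
  then show "EL L (x j) (v j) (a j) = 0" by (simp add: vec_eq_iff)
next
  fix j c assume "PhiN xb L = (pb, cb)" "\<forall>j. EL L (x j) (v j) (a j) = 0"
  then show "cond_functional x v a xb c L = cond_value pb cb c" by (cases c) auto
qed

theorem theorem6p1:
  fixes \<Omega> :: "((real^'d) \<times> (real^'d)) set"
    and x v a :: "nat \<Rightarrow> real^'d"
    and Lref :: "(real^'d) \<times> (real^'d) \<Rightarrow> real"
    and K :: "(real^'d) \<times> (real^'d) \<Rightarrow> (real^'d) \<times> (real^'d) \<Rightarrow> real"
    and xb :: "(real^'d) \<times> (real^'d)"
    and pb :: "real^'d" and cb :: real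
    and U :: "((real^'d) \<times> (real^'d) \<Rightarrow> real) set"
    and ip :: "((real^'d) \<times> (real^'d) \<Rightarrow> real) \<Rightarrow> ((real^'d) \<times> (real^'d) \<Rightarrow> real) \<Rightarrow> real"
    and M :: "'w measure"
    and \<xi> :: "(((real^'d) \<times> (real^'d) \<Rightarrow> real) \<Rightarrow> real) \<Rightarrow> 'w \<Rightarrow> real"
    and Lseq :: "nat \<Rightarrow> (real^'d) \<times> (real^'d) \<Rightarrow> real"
  assumes "open \<Omega>" and "bounded \<Omega>" and "\<Omega> \<noteq> {}"
    and "\<And>j. (x j, v j) \<in> \<Omega>"
    and "Ck_closure 2 \<Omega> Lref" and "nondegenerate \<Omega> Lref"
    and "\<And>j. EL Lref (x j) (v j) (a j) = 0"
    and "\<Omega> \<subseteq> closure (range (\<lambda>j. (x j, v j)))"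
    and "pd_kernel \<Omega> K" and "Ck_on 4 (\<Omega> \<times> \<Omega>) (\<lambda>(p, q). K p q)"
    and "xb \<in> \<Omega>"
    and "is_rkhs \<Omega> K U ip"
    and "Lref \<in> U" and "PhiN xb Lref = (pb, cb)"
    and "continuously_embedded_Ck 2 \<Omega> U ip"
    and "canonical_gaussian_field M \<Omega> K U ip \<xi>"
    and "\<And>j. Lseq j = cond_mean M U ip \<xi> (cond_indices j)
                          (cond_functional x v a xb) (cond_value pb cb)"
  shows "\<exists>Linf \<in> U.
           (\<lambda>j. ip_norm ip (\<lambda>p. Lseq j p - Linf p)) \<longlonglongrightarrow> 0 \<and>
           (\<lambda>j. Ck_norm 2 \<Omega> (\<lambda>p. Lseq j p - Linf p)) \<longlonglongrightarrow> 0 \<and>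
           PhiN xb Linf = (pb, cb) \<and>
           dynamics_consistent \<Omega> Lref Linf \<and>
           (\<forall>L. is_arg_min (ip_norm ip)
                  (\<lambda>L. L \<in> U \<and> PhiN xb L = (pb, cb) \<and> dynamics_consistent \<Omega> Lref L) L
                \<longleftrightarrow> L = Linf)"
proof -
  note \<Omega> = \<open>open \<Omega>\<close> \<open>bounded \<Omega>\<close> and pts = assms(4) and emb = \<open>continuously_embedded_Ck 2 \<Omega> U ip\<close>
  interpret hilbert_functions \<Omega> U ip
    using \<open>is_rkhs \<Omega> K U ip\<close> by unfold_locales (simp add: is_rkhs_def)
  define \<Phi> where "\<Phi> = cond_functional x v a xb"
  define adm where "adm = (\<lambda>L. L \<in> U \<and> PhiN xb L = (pb, cb) \<and> dynamics_consistent \<Omega> Lref L)"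
  have \<Phi>: "\<Phi> c \<in> dual_space U ip" for c
    unfolding \<Phi>_def using \<Omega> emb pts \<open>xb \<in> \<Omega>\<close> by (rule cond_functional_in_dual_space)
  have "\<forall>c. \<exists>r. r \<in> U \<and> (\<forall>f\<in>U. \<Phi> c f = ip f r)" using riesz[OF \<Phi>] by blast
  from choice[OF this] obtain r where r: "\<And>c. r c \<in> U" "\<And>c f. f \<in> U \<Longrightarrow> \<Phi> c f = ip f (r c)" by blast
  have C2: "Ck_closure 2 \<Omega> L" if "L \<in> U" for L
    using emb that by (simp add: continuously_embedded_Ck_def)
  have adm_iff: "adm L \<longleftrightarrow> (\<forall>j. \<forall>c\<in>cond_indices j. ip L (r c) = cond_value pb cb c)" if "L \<in> U" for L
  proof -
    \<comment> \<open>Density of the observations and non-degeneracy of \<open>Lref\<close> enter here.\<close>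
    have "dynamics_consistent \<Omega> Lref L \<longleftrightarrow> (\<forall>j. EL L (x j) (v j) (a j) = 0)"
    proof
      assume "dynamics_consistent \<Omega> Lref L"
      then show "\<forall>j. EL L (x j) (v j) (a j) = 0"
        using pts assms(7) unfolding dynamics_consistent_def by blast
    next
      assume *: "\<forall>j. EL L (x j) (v j) (a j) = 0"
      show "dynamics_consistent \<Omega> Lref L"
      proof (rule dynamics_consistent_if_dense[OF _ assms(6) _ pts assms(8) assms(7)])
        show "Ck_on 2 \<Omega> Lref" "Ck_on 2 \<Omega> L"
          using assms(5) C2[OF that] by (simp_all add: Ck_closure_def)
      qed (use * in blast)
    qed
    then show ?thesis
      using conditions_iff[of x v a xb L pb cb] that r(2)[OF that] by (simp add: adm_def \<Phi>_def)
  qed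
  have "adm Lref" using assms(13,14) by (simp add: adm_def dynamics_consistent_def)
  then have ref: "ip Lref (r k) = cond_value pb cb k" if "k \<in> cond_indices j" for j k
    using adm_iff[OF \<open>Lref \<in> U\<close>] that by blast
  \<comment> \<open>\<open>Lref\<close> satisfies all conditions, so its projection onto the span of the first representers is the
    interpolant of the first conditions.\<close>
  have "\<forall>j. \<exists>c. \<forall>k\<in>cond_indices j. ip (\<lambda>p. Lref p - (\<Sum>i\<in>cond_indices j. c i * r i p)) (r k) = 0"
    by (intro allI ex_projection_coeffs finite_cond_indices r \<open>Lref \<in> U\<close>)
  from choice[OF this] obtain c where c: "\<And>j k. k \<in> cond_indices j \<Longrightarrow>
      ip (\<lambda>p. Lref p - (\<Sum>i\<in>cond_indices j. c j i * r i p)) (r k) = 0" by blast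
  define L where "L = (\<lambda>j p. \<Sum>i\<in>cond_indices j. c j i * r i p)"
  have LU: "L j \<in> U" for j unfolding L_def by (intro sum_mem r)
  have interp: "ip (L j) (r k) = ip Lref (r k)" if "k \<in> cond_indices j" for j k
    using c[OF that] ip_diff[OF \<open>Lref \<in> U\<close> LU r(1), of j k] by (simp add: L_def)
  have Lseq: "Lseq j = L j" for j
    unfolding assms(17)
  proof (rule cond_mean_eq_interpolant[OF assms(12,16) finite_cond_indices])
    show "L j = (\<lambda>p. \<Sum>i\<in>cond_indices j. c j i * r i p)" by (simp add: L_def)
    show "cond_functional x v a xb i (L j) = cond_value pb cb i" if "i \<in> cond_indices j" for i
      using interp[OF that] ref[OF that] r(2)[OF LU] by (simp add: \<Phi>_def)
  qed (use \<Phi> r in \<open>auto simp: \<Phi>_def\<close>)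
  obtain Linf where Linf: "Linf \<in> U" "(\<lambda>j. ip_norm ip (\<lambda>p. L j p - Linf p)) \<longlonglongrightarrow> 0"
    "\<forall>j. \<forall>k\<in>cond_indices j. ip Linf (r k) = ip Lref (r k)"
    "\<And>f. f \<in> U \<Longrightarrow> \<forall>j. \<forall>k\<in>cond_indices j. ip f (r k) = ip Lref (r k) \<Longrightarrow>
      ip f f = ip Linf Linf + ip (\<lambda>p. f p - Linf p) (\<lambda>p. f p - Linf p)"
    using nested_interpolation_converges[where r=r and I=cond_indices and c=c and L=L and G=Lref,
        OF r(1) \<open>Lref \<in> U\<close> mono_cond_indices _ interp]
    unfolding L_def by blast
  have adm_Linf: "adm Linf" using adm_iff[OF Linf(1)] Linf(3) ref by metis
  have pyth: "ip f f = ip Linf Linf + ip (\<lambda>p. f p - Linf p) (\<lambda>p. f p - Linf p)" if "adm f" for f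
  proof -
    have "f \<in> U" using that by (simp add: adm_def)
    then show ?thesis using Linf(4) adm_iff that ref by metis
  qed
  have Ck: "(\<lambda>j. Ck_norm 2 \<Omega> (\<lambda>p. L j p - Linf p)) \<longlonglongrightarrow> 0"
  proof -
    obtain C where C: "\<And>f. f \<in> U \<Longrightarrow> Ck_norm 2 \<Omega> f \<le> C * ip_norm ip f"
      using emb unfolding continuously_embedded_Ck_def by blast
    have d: "(\<lambda>p. L j p - Linf p) \<in> U" for j using LU Linf(1) by (rule diff_mem)
    show ?thesis
    proof (rule tendsto_sandwich[OF _ _ tendsto_const])
      show "(\<lambda>j. C * ip_norm ip (\<lambda>p. L j p - Linf p)) \<longlonglongrightarrow> 0"
        using tendsto_mult_left[OF Linf(2), of C] by simp
      show "\<forall>\<^sub>F j in sequentially. 0 \<le> Ck_norm 2 \<Omega> (\<lambda>p. L j p - Linf p)"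
        using Ck_norm_nonneg[OF \<open>bounded \<Omega>\<close> C2[OF d] \<open>\<Omega> \<noteq> {}\<close>] by simp
      show "\<forall>\<^sub>F j in sequentially. Ck_norm 2 \<Omega> (\<lambda>p. L j p - Linf p) \<le> C * ip_norm ip (\<lambda>p. L j p - Linf p)"
        using C[OF d] by simp
    qed
  qed
  have min: "is_arg_min (ip_norm ip) adm f \<longleftrightarrow> f = Linf" for f
  proof
    assume f: "is_arg_min (ip_norm ip) adm f"
    then have "adm f" and "\<not> ip_norm ip Linf < ip_norm ip f"
      using adm_Linf by (auto simp: is_arg_min_def)
    then have "f \<in> U" "ip f f \<le> ip Linf Linf" by (auto simp: adm_def ip_norm_def)
    then have d: "(\<lambda>p. f p - Linf p) \<in> U" using Linf(1) by (intro diff_mem)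
    have "ip (\<lambda>p. f p - Linf p) (\<lambda>p. f p - Linf p) = 0"
      using pyth[OF \<open>adm f\<close>] \<open>ip f f \<le> ip Linf Linf\<close> ip_nonneg[OF d] by linarith
    then have "(\<lambda>p. f p - Linf p) = (\<lambda>p. 0)" by (rule ip_eq_0[OF d])
    then show "f = Linf" by (simp add: fun_eq_iff)
  next
    have "\<not> ip_norm ip g < ip_norm ip Linf" if "adm g" for g
    proof -
      have "(\<lambda>p. g p - Linf p) \<in> U" using that Linf(1) by (intro diff_mem) (simp_all add: adm_def)
      from ip_nonneg[OF this] show ?thesis using pyth[OF that] by (simp add: ip_norm_def)
    qed
    then show "is_arg_min (ip_norm ip) adm f" if "f = Linf"
      using adm_Linf that by (auto simp: is_arg_min_def)
  qed
  show ?thesis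
    using Linf(1,2) Ck adm_Linf min unfolding Lseq adm_def by blast
qed

end
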